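(* Let $\mathfrak{G}$ be the Grigorchuk $2$-group, acting on the binary rooted tree, and for $n \geq 1$ let $\operatorname{Stab}_{\mathfrak{G}}(n)$ be its $n$th level stabiliser. Then $$\operatorname{diam}\big(\mathfrak{G}/\operatorname{Stab}_{\mathfrak{G}}(n)\big) = O\big(\exp(\log(35)\, n)\big)$$ and $$\operatorname{diam}\big(\mathfrak{G}/\operatorname{Stab}_{\mathfrak{G}}(n)\big) = O\Big(\big(\log|\mathfrak{G}:\operatorname{Stab}_{\mathfrak{G}}(n)|\big)^{\log(35)/\log(2)}\Big),$$ where the implied constants are absolute (independent of $n$).
   Context: Diameter: for a finite group $G$ and a generating set $S\subseteq G$, $B_S(n)$ is the closed ball of radius $n$ about the identity in the word metric of $S$, i.e. the set of products of at most $n$ elements of $S\cup S^{-1}$; $\operatorname{diam}(G,S)=\min\{n\in\mathbb{N}: B_S(n)=G\}$; and $\operatorname{diam}(G)$ is the maximum of $\operatorname{diam}(G,S)$ over all generating sets $S$ of $G$. Tree: let $\mathcal{A}=\{0,1\}$ and let $\mathcal{A}^*$ be the set of finite words over $\mathcal{A}$, viewed as the vertex set of the binary rooted tree $\mathcal{T}_2$ (root the empty word; each word $v$ is joined to $v0$ and $v1$). $\operatorname{Aut}(\mathcal{T}_2)$ is the group of permutations of $\mathcal{A}^*$ preserving the prefix relation. $\operatorname{Stab}(n)$ is the kernel of its action on the set $\mathcal{A}^n$ of words of length $n$, and $\operatorname{Stab}_\Gamma(n)=\Gamma\cap\operatorname{Stab}(n)$ for $\Gamma\leq\operatorname{Aut}(\mathcal{T}_2)$.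 The Grigorchuk $2$-group $\mathfrak{G}$ is the subgroup of $\operatorname{Aut}(\mathcal{T}_2)$ generated by $a,b,c,d$, defined recursively, for all words $w$, by $a(0w)=1w$, $a(1w)=0w$; $b(0w)=0a(w)$, $b(1w)=1c(w)$; $c(0w)=0a(w)$, $c(1w)=1d(w)$; $d(0w)=0w$, $d(1w)=1b(w)$. *)

theory Defs
  imports Complex_Main "HOL-Library.Sublist" "HOL-Algebra.Algebra"
begin

section \<open>Diameter of a finite group\<close>

definition word_ball :: "('a, 'b) monoid_scheme \<Rightarrow> 'a set \<Rightarrow> nat \<Rightarrow> 'a set" where
  "word_ball G S n =
     {foldr (\<otimes>\<^bsub>G\<^esub>) xs \<one>\<^bsub>G\<^esub> | xs. set xs \<subseteq> S \<union> set_inv\<^bsub>G\<^esub> S \<and> length xs \<le> n}"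

definition generates :: "('a, 'b) monoid_scheme \<Rightarrow> 'a set \<Rightarrow> bool" where
  "generates G S \<longleftrightarrow> S \<subseteq> carrier G \<and> generate G S = carrier G"

definition diam_wrt :: "('a, 'b) monoid_scheme \<Rightarrow> 'a set \<Rightarrow> nat" where
  "diam_wrt G S = (LEAST n. word_ball G S n = carrier G)"

text \<open>The minimum in \<^const>\<open>diam_wrt\<close> and the maximum below are only meaningful for finite
  groups; the lemmas \<open>diam_wrt_attained\<close> and \<open>diam_set_finite_nonempty\<close> show that
  they exist in that case.\<close>

definition diam :: "('a, 'b) monoid_scheme \<Rightarrow> nat" where
  "diam G = Max {diam_wrt G S | S. generates G S}"

lemma (in group) foldr_mult_closed:
  "set xs \<subseteq> carrier G \<Longrightarrow> foldr (\<otimes>) xs \<one> \<in> carrier G"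
  by (induction xs) auto

lemma (in group) foldr_mult_append:
  "set xs \<subseteq> carrier G \<Longrightarrow> set ys \<subseteq> carrier G \<Longrightarrow>
   foldr (\<otimes>) (xs @ ys) \<one> = foldr (\<otimes>) xs \<one> \<otimes> foldr (\<otimes>) ys \<one>"
  by (induction xs) (auto simp: foldr_mult_closed m_assoc)

lemma (in group) set_inv_subset: "S \<subseteq> carrier G \<Longrightarrow> set_inv S \<subseteq> carrier G"
  by (auto simp: SET_INV_def)

lemma (in group) word_ball_subset: "S \<subseteq> carrier G \<Longrightarrow> word_ball G S n \<subseteq> carrier G"
  unfolding word_ball_def using set_inv_subset[of S] foldr_mult_closed by blast

lemma word_ball_mono: "m \<le> n \<Longrightarrow> word_ball G S m \<subseteq> word_ball G S n"
  unfolding word_ball_def by fastforce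

lemma (in group) generate_imp_word_ball:
  assumes "S \<subseteq> carrier G" "x \<in> generate G S"
  shows "\<exists>n. x \<in> word_ball G S n"
proof -
  have sub: "S \<union> set_inv S \<subseteq> carrier G"
    using assms(1) set_inv_subset by blast
  have "\<exists>xs. set xs \<subseteq> S \<union> set_inv S \<and> x = foldr (\<otimes>) xs \<one>"
    using assms(2)
  proof (induction rule: generate.induct)
    case one
    then show ?case by (intro exI[of _ "[]"]) auto
  next
    case (incl h)
    then show ?case using assms(1) by (intro exI[of _ "[h]"]) auto
  next
    case (inv h)
    then show ?case using assms(1) by (intro exI[of _ "[inv h]"]) (auto simp: SET_INV_def)
  next
    case (eng h1 h2)
    then obtain xs ys where "set xs \<subseteq> S \<union> set_inv S" "h1 = foldr (\<otimes>) xs \<one>"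
        "set ys \<subseteq> S \<union> set_inv S" "h2 = foldr (\<otimes>) ys \<one>" by blast
    moreover from this sub have "set xs \<subseteq> carrier G" "set ys \<subseteq> carrier G" by blast+
    ultimately show ?case
      using foldr_mult_append[of xs ys] by (intro exI[of _ "xs @ ys"]) auto
  qed
  then show ?thesis unfolding word_ball_def by blast
qed

lemma (in group) diam_wrt_attained:
  assumes fin: "finite (carrier G)" and gen: "generates G S"
  shows "word_ball G S (diam_wrt G S) = carrier G"
proof -
  have S: "S \<subseteq> carrier G" and "\<forall>x\<in>carrier G. \<exists>n. x \<in> word_ball G S n"
    using gen generate_imp_word_ball by (auto simp: generates_def)
  then obtain f where f: "\<forall>x\<in>carrier G. x \<in> word_ball G S (f x)" by metis
  have "x \<in> word_ball G S (Max (f ` carrier G))" if "x \<in> carrier G" for x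
    using f that fin word_ball_mono[of "f x" "Max (f ` carrier G)" G S] by (auto intro: Max_ge)
  then have "word_ball G S (Max (f ` carrier G)) = carrier G"
    using word_ball_subset[OF S] by blast
  then show ?thesis unfolding diam_wrt_def by (rule LeastI)
qed

lemma (in group) diam_set_finite_nonempty:
  assumes "finite (carrier G)"
  shows "finite {diam_wrt G S | S. generates G S}" "{diam_wrt G S | S. generates G S} \<noteq> {}"
proof -
  have "{diam_wrt G S | S. generates G S} \<subseteq> diam_wrt G ` Pow (carrier G)"
    by (auto simp: generates_def)
  then show "finite {diam_wrt G S | S. generates G S}"
    using assms by (meson finite_Pow_iff finite_imageI finite_subset)
  have "generates G (carrier G)"
    unfolding generates_def using generate_incl[of "carrier G"] by (auto intro: generate.incl)
  then show "{diam_wrt G S | S. generates G S} \<noteq> {}" by blast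
qed


section \<open>Automorphisms of the binary rooted tree\<close>

text \<open>Vertices are finite words over \<open>{0, 1}\<close>, with \<^const>\<open>False\<close> for the letter 0 and
  \<^const>\<open>True\<close> for 1.\<close>

type_synonym vertex = "bool list"

definition tree_aut :: "(vertex \<Rightarrow> vertex) monoid" where
  "tree_aut = (BijGroup UNIV)
     \<lparr>carrier := {f \<in> carrier (BijGroup UNIV). \<forall>u v. prefix (f u) (f v) \<longleftrightarrow> prefix u v}\<rparr>"

definition level_stab :: "nat \<Rightarrow> (vertex \<Rightarrow> vertex) set" where
  "level_stab n = {g \<in> carrier tree_aut. \<forall>w. length w = n \<longrightarrow> g w = w}"

definition level_stab_in :: "(vertex \<Rightarrow> vertex) monoid \<Rightarrow> nat \<Rightarrow> (vertex \<Rightarrow> vertex) set" where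
  "level_stab_in \<Gamma> n = carrier \<Gamma> \<inter> level_stab n"


section \<open>The Grigorchuk group\<close>

fun grig_a :: "vertex \<Rightarrow> vertex" where
  "grig_a [] = []"
| "grig_a (False # w) = True # w"
| "grig_a (True # w) = False # w"

fun grig_b :: "vertex \<Rightarrow> vertex"
  and grig_c :: "vertex \<Rightarrow> vertex"
  and grig_d :: "vertex \<Rightarrow> vertex" where
  "grig_b [] = []"
| "grig_b (False # w) = False # grig_a w"
| "grig_b (True # w) = True # grig_c w"
| "grig_c [] = []"
| "grig_c (False # w) = False # grig_a w"
| "grig_c (True # w) = True # grig_d w"
| "grig_d [] = []"
| "grig_d (False # w) = False # w"
| "grig_d (True # w) = True # grig_b w"

definition grigorchuk :: "(vertex \<Rightarrow> vertex) monoid" where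
  "grigorchuk = tree_aut\<lparr>carrier := generate tree_aut {grig_a, grig_b, grig_c, grig_d}\<rparr>"


section \<open>Well-definedness\<close>

lemma carrier_tree_aut:
  "carrier tree_aut = {f. bij f \<and> (\<forall>u v. prefix (f u) (f v) \<longleftrightarrow> prefix u v)}"
  by (simp add: tree_aut_def BijGroup_def Bij_def extensional_def)

lemma mult_tree_aut:
  "f \<in> carrier tree_aut \<Longrightarrow> g \<in> carrier tree_aut \<Longrightarrow> f \<otimes>\<^bsub>tree_aut\<^esub> g = f \<circ> g"
  by (auto simp: tree_aut_def BijGroup_def compose_def fun_eq_iff)

lemma one_tree_aut: "\<one>\<^bsub>tree_aut\<^esub> = id"
  by (simp add: tree_aut_def BijGroup_def fun_eq_iff)

lemma group_tree_aut: "group tree_aut"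
proof (rule groupI)
  fix f g h
  assume f: "f \<in> carrier tree_aut"
  show "\<one>\<^bsub>tree_aut\<^esub> \<otimes>\<^bsub>tree_aut\<^esub> f = f"
    using f by (subst mult_tree_aut) (auto simp: one_tree_aut carrier_tree_aut)
  show "\<exists>g\<in>carrier tree_aut. g \<otimes>\<^bsub>tree_aut\<^esub> f = \<one>\<^bsub>tree_aut\<^esub>"
  proof
    have bij: "bij f" using f by (simp add: carrier_tree_aut)
    show inv: "inv_into UNIV f \<in> carrier tree_aut"
      using f bij by (simp add: carrier_tree_aut bij_imp_bij_inv)
        (metis bij bij_inv_eq_iff)
    show "inv_into UNIV f \<otimes>\<^bsub>tree_aut\<^esub> f = \<one>\<^bsub>tree_aut\<^esub>"
      using bij by (simp add: mult_tree_aut[OF inv f] one_tree_aut bij_is_inj)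
  qed
  assume g: "g \<in> carrier tree_aut"
  have comp: "f \<circ> g \<in> carrier tree_aut" if "f \<in> carrier tree_aut" "g \<in> carrier tree_aut" for f g
    using that by (simp add: carrier_tree_aut bij_comp)
  show "f \<otimes>\<^bsub>tree_aut\<^esub> g \<in> carrier tree_aut"
    using f g comp by (simp add: mult_tree_aut)
  assume h: "h \<in> carrier tree_aut"
  show "f \<otimes>\<^bsub>tree_aut\<^esub> g \<otimes>\<^bsub>tree_aut\<^esub> h = f \<otimes>\<^bsub>tree_aut\<^esub> (g \<otimes>\<^bsub>tree_aut\<^esub> h)"
    using f g h comp by (simp add: mult_tree_aut comp_assoc)
qed (simp add: one_tree_aut carrier_tree_aut)

lemma length_tree_aut:
  assumes "f \<in> carrier tree_aut"
  shows "length (f w) = length w"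
proof -
  have f: "bij f" "\<And>u v. prefix (f u) (f v) \<longleftrightarrow> prefix u v"
    using assms by (auto simp: carrier_tree_aut)
  have num: "card {u. prefix u v} = Suc (length v)" for v :: vertex
  proof -
    have "{u. prefix u v} = set (prefixes v)" by auto
    then show ?thesis by (simp add: distinct_card)
  qed
  have "f ` {u. prefix u w} = {u. prefix u (f w)}"
    using f by (auto simp: image_iff) (metis bij_pointE)
  then have "card {u. prefix u (f w)} = card {u. prefix u w}"
    using f(1) by (metis bij_is_inj card_image inj_on_subset subset_UNIV)
  then show ?thesis by (simp add: num)
qed

lemma grig_involution:
  "grig_a (grig_a w) = w" "grig_b (grig_b w) = w" "grig_c (grig_c w) = w" "grig_d (grig_d w) = w"
proof -
  show a: "grig_a (grig_a w) = w" for w by (cases w rule: grig_a.cases) auto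
  show "grig_b (grig_b w) = w" "grig_c (grig_c w) = w" "grig_d (grig_d w) = w"
    by (induction w and w and w rule: grig_b_grig_c_grig_d.induct) (auto simp: a)
qed

lemma grig_prefix:
  "prefix u v \<Longrightarrow> prefix (grig_a u) (grig_a v)"
  "prefix u v \<Longrightarrow> prefix (grig_b u) (grig_b v)"
  "prefix u v \<Longrightarrow> prefix (grig_c u) (grig_c v)"
  "prefix u v \<Longrightarrow> prefix (grig_d u) (grig_d v)"
proof -
  show a: "prefix (grig_a u) (grig_a v)" if "prefix u v" for u v
    using that by (cases u rule: grig_a.cases; cases v rule: grig_a.cases) auto
  have "(\<forall>v. prefix u v \<longrightarrow> prefix (grig_b u) (grig_b v)) \<and>
        (\<forall>v. prefix u v \<longrightarrow> prefix (grig_c u) (grig_c v)) \<and>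
        (\<forall>v. prefix u v \<longrightarrow> prefix (grig_d u) (grig_d v))"
  proof (induction u)
    case (Cons x u)
    have "prefix (x # u) v \<longleftrightarrow> (\<exists>v'. v = x # v' \<and> prefix u v')" for v
      by (auto simp: prefix_def)
    with Cons show ?case by (cases x) (auto simp: a)
  qed auto
  then show "prefix u v \<Longrightarrow> prefix (grig_b u) (grig_b v)"
    "prefix u v \<Longrightarrow> prefix (grig_c u) (grig_c v)"
    "prefix u v \<Longrightarrow> prefix (grig_d u) (grig_d v)" by auto
qed

lemma grig_generators_tree_aut: "{grig_a, grig_b, grig_c, grig_d} \<subseteq> carrier tree_aut"
proof -
  have "f \<in> carrier tree_aut"
    if "\<And>w. f (f w) = w" "\<And>u v. prefix u v \<Longrightarrow> prefix (f u) (f v)" for f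
    using that by (auto simp: carrier_tree_aut intro: involuntory_imp_bij) metis
  then show ?thesis by (simp add: grig_involution grig_prefix)
qed

lemma subgroup_grigorchuk: "subgroup (carrier grigorchuk) tree_aut"
  using group.generate_is_subgroup[OF group_tree_aut grig_generators_tree_aut]
  by (simp add: grigorchuk_def)

lemma group_grigorchuk: "group grigorchuk"
  using subgroup.subgroup_is_group[OF subgroup_grigorchuk group_tree_aut]
  by (simp add: grigorchuk_def)

lemma normal_level_stab: "level_stab n \<lhd> tree_aut"
proof -
  interpret group tree_aut by (rule group_tree_aut)
  have app: "(inv\<^bsub>tree_aut\<^esub> g) (g w) = w" "g ((inv\<^bsub>tree_aut\<^esub> g) w) = w"
    if "g \<in> carrier tree_aut" for g w
    using that mult_tree_aut[of "inv\<^bsub>tree_aut\<^esub> g" g] mult_tree_aut[of g "inv\<^bsub>tree_aut\<^esub> g"]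
    by (auto simp: one_tree_aut fun_eq_iff)
  show ?thesis
  proof (rule normal_invI)
    show "subgroup (level_stab n) tree_aut"
    proof (rule subgroupI)
      show "level_stab n \<noteq> {}" using one_closed by (auto simp: level_stab_def one_tree_aut)
    next
      fix g assume "g \<in> level_stab n"
      then show "inv\<^bsub>tree_aut\<^esub> g \<in> level_stab n"
        by (auto simp: level_stab_def) (metis app(1))
    qed (auto simp: level_stab_def, simp add: mult_tree_aut)
  next
    fix x h assume x: "x \<in> carrier tree_aut" and h: "h \<in> level_stab n"
    have hc: "h \<in> carrier tree_aut" using h by (simp add: level_stab_def)
    have "(x \<otimes>\<^bsub>tree_aut\<^esub> h \<otimes>\<^bsub>tree_aut\<^esub> inv\<^bsub>tree_aut\<^esub> x) w = w" if "length w = n" for w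
    proof -
      have "length ((inv\<^bsub>tree_aut\<^esub> x) w) = n" using that x length_tree_aut by simp
      then have "h ((inv\<^bsub>tree_aut\<^esub> x) w) = (inv\<^bsub>tree_aut\<^esub> x) w"
        using h by (simp add: level_stab_def)
      moreover have "(x \<otimes>\<^bsub>tree_aut\<^esub> h \<otimes>\<^bsub>tree_aut\<^esub> inv\<^bsub>tree_aut\<^esub> x) = x \<circ> h \<circ> inv\<^bsub>tree_aut\<^esub> x"
        using x hc by (metis inv_closed m_closed mult_tree_aut)
      ultimately show ?thesis using app(2)[OF x] by simp
    qed
    then show "x \<otimes>\<^bsub>tree_aut\<^esub> h \<otimes>\<^bsub>tree_aut\<^esub> inv\<^bsub>tree_aut\<^esub> x \<in> level_stab n"
      using x hc by (simp add: level_stab_def)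
  qed
qed

lemma normal_level_stab_grigorchuk: "level_stab_in grigorchuk n \<lhd> grigorchuk"
proof -
  have "level_stab n \<inter> carrier grigorchuk \<lhd> tree_aut\<lparr>carrier := carrier grigorchuk\<rparr>"
    using group.normal_Int_subgroup[OF group_tree_aut subgroup_grigorchuk normal_level_stab] .
  moreover have "tree_aut\<lparr>carrier := carrier grigorchuk\<rparr> = grigorchuk"
    by (simp add: grigorchuk_def)
  ultimately show ?thesis by (simp add: level_stab_in_def Int_commute)
qed

lemma group_grigorchuk_quotient: "group (grigorchuk Mod level_stab_in grigorchuk n)"
  by (rule normal.factorgroup_is_group[OF normal_level_stab_grigorchuk])

lemma finite_grigorchuk_quotient: "finite (carrier (grigorchuk Mod level_stab_in grigorchuk n))"
proof -
  interpret G: group grigorchuk by (rule group_grigorchuk)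
  interpret A: group tree_aut by (rule group_tree_aut)
  let ?N = "level_stab_in grigorchuk n"
  let ?L = "{w :: vertex. length w = n}"
  interpret N: normal ?N grigorchuk by (rule normal_level_stab_grigorchuk)
  define r where "r = (\<lambda>g :: vertex \<Rightarrow> vertex. restrict g ?L)"
  define C where "C = (\<lambda>g. ?N #>\<^bsub>grigorchuk\<^esub> g)"
  have sub: "carrier grigorchuk \<subseteq> carrier tree_aut"
    using subgroup.subset[OF subgroup_grigorchuk] .
  have fin: "finite ?L" using finite_lists_length_eq[of "UNIV :: bool set" n] by simp
  have eq: "C g = C h"
    if g: "g \<in> carrier grigorchuk" and h: "h \<in> carrier grigorchuk" and r: "r g = r h" for g h
  proof -
    define k where "k = g \<otimes>\<^bsub>grigorchuk\<^esub> inv\<^bsub>grigorchuk\<^esub> h"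
    have kc: "k \<in> carrier grigorchuk" using g h by (simp add: k_def)
    have kh: "k \<otimes>\<^bsub>grigorchuk\<^esub> h = g" using g h by (simp add: k_def G.m_assoc)
    then have comp: "k \<circ> h = g"
      using mult_tree_aut[of k h] subsetD[OF sub kc] subsetD[OF sub h]
      by (simp add: grigorchuk_def)
    have "k w = w" if w: "length w = n" for w
    proof -
      have hb: "bij h" and ht: "h \<in> carrier tree_aut"
        using h sub by (auto simp: carrier_tree_aut)
      then obtain v where v: "w = h v" by (metis bij_pointE)
      then have "length v = n" using length_tree_aut[OF ht] w by simp
      then have "g v = h v" using r by (auto simp: r_def fun_eq_iff restrict_def split: if_splits)
      then show ?thesis using comp v by auto
    qed
    then have kN: "k \<in> ?N" using kc sub by (auto simp: level_stab_in_def level_stab_def)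
    have "g \<in> C h" unfolding C_def r_coset_def using kN kh by auto
    then show ?thesis
      using G.repr_independence[of g ?N h] h N.subgroup_axioms by (simp add: C_def)
  qed
  have "r ` carrier grigorchuk \<subseteq> ?L \<rightarrow>\<^sub>E ?L"
    using length_tree_aut sub by (auto simp: r_def PiE_iff split: if_splits)
  then have finr: "finite (r ` carrier grigorchuk)"
    using fin by (meson finite_PiE finite_subset)
  have "C ` carrier grigorchuk \<subseteq> (\<lambda>x. C (inv_into (carrier grigorchuk) r x)) ` r ` carrier grigorchuk"
  proof (rule image_subsetI)
    fix g assume g: "g \<in> carrier grigorchuk"
    then have "C g = C (inv_into (carrier grigorchuk) r (r g))"
      by (intro eq) (auto simp: inv_into_into f_inv_into_f)
    then show "C g \<in> (\<lambda>x. C (inv_into (carrier grigorchuk) r x)) ` r ` carrier grigorchuk"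
      using g by blast
  qed
  then have "finite (C ` carrier grigorchuk)" using finr by (meson finite_imageI finite_subset)
  then show ?thesis by (simp add: carrier_FactGroup C_def)
qed

end

theory Submission
  imports Defs
begin

text \<open>
  Write \<open>G\<close> for the Grigorchuk group, \<open>t = (ab)\<^sup>2\<close>, \<open>(x, y)\<close> for the automorphism that acts by
  \<open>x\<close> and \<open>y\<close> on the two halves of the tree, and \<open>[g, x] = g x g\<^sup>-\<^sup>1 x\<^sup>-\<^sup>1\<close>. Let \<open>K\<close> be the normal
  closure of \<open>t\<close> in \<open>G\<close>; it contains \<open>K \<times> K\<close>, that is, \<open>G\<close> is regular branch over \<open>K\<close>. Put
  \<open>M = \<langle>t\<^sup>2, K \<times> K\<rangle>\<close> and \<open>L = \<langle>(t, t), M \<times> M\<rangle>\<close>. Then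
  \<open>M \<times> M \<le> L \<le> K \<times> K \<le> M \<le> K\<close>, and \<open>[G, K] \<le> M\<close>, \<open>[G, M] \<le> L\<close>, \<open>[G, L] \<le> M \<times> M\<close>.
  Placing one copy of a group at each of the \<open>2\<^sup>j\<close> vertices of level \<open>j\<close> gives subgroups
  \<open>K\<^sub>j\<close>, \<open>M\<^sub>j\<close>, \<open>L\<^sub>j\<close> of \<open>G\<close> that fix level \<open>j\<close>.

  The proof is a Solovay-Kitaev descent along
  \<open>M\<^sub>1 \<ge> L\<^sub>1 \<ge> M\<^sub>2 \<ge> L\<^sub>2 \<ge> \<dots>\<close>. Suppose that the ball of radius \<open>l\<close>, for some generating set of the
  quotient, meets every coset of \<open>M\<^sub>j\<close>. The group \<open>M\<^sub>j\<close> is central modulo \<open>L\<^sub>j\<close> in \<open>K\<^sub>j\<^sub>-\<^sub>1\<close>, its squares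
  lie in \<open>L\<^sub>j\<close>, and each of its elements has modulo \<open>L\<^sub>j\<close> the form \<open>x\<^sup>2 [z, y]\<close> with \<open>x, y, z\<close>
  in \<open>K\<^sub>j\<^sub>-\<^sub>1\<close>. Changing \<open>x, y, z\<close> by elements of \<open>M\<^sub>j\<close> does not change this value modulo \<open>L\<^sub>j\<close>, so
  they may be taken in the ball. Correcting an approximation modulo \<open>M\<^sub>j\<close> by such a product
  gives one modulo \<open>L\<^sub>j\<close> of length at most \<open>l + 2l + 4l = 7l\<close>. From \<open>L\<^sub>j\<close> to \<open>M\<^sub>j\<^sub>+\<^sub>1\<close> a single commutator
  suffices, at a cost of \<open>1 + 4 = 5\<close> times the length. Hence the radius grows by the factor
  \<open>5 \<cdot> 7 = 35\<close> for each level (\<open>covers_35\<close>). The descent starts at \<open>M\<^sub>1 = M \<times> M\<close>: this subgroup has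
  finite index in \<open>G\<close>, and for every generating set the ball whose radius is that index meets all
  its cosets (\<open>covers_card\<close>). As \<open>M\<^sub>n\<close> fixes level \<open>n\<close>, the first bound follows.

  For the second bound, independent choices of \<open>1\<close> or \<open>t\<close> at the \<open>2\<^sup>n\<^sup>-\<^sup>2\<close> vertices of level \<open>n - 2\<close>
  give elements of \<open>G\<close> that act differently on level \<open>n\<close>. So the logarithm of the index of the
  level stabiliser is at least a constant times \<open>2\<^sup>n\<close>, and \<open>35\<^sup>n = (2\<^sup>n)\<^bsup>log 35 / log 2\<^esup>\<close>.
\<close>

section \<open>Groups as a type class\<close>

text \<open>The group of all tree automorphisms becomes a type below, so that products, inverses and
  sections are total and the simplifier can decide the word problem of free groups without side
  conditions. The rules declared here form the usual confluent rewriting system for groups,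
  together with associativity.\<close>


class mult_group = monoid_mult + inverse +
  assumes left_inv [simp]: "inverse x * x = 1"
begin

lemma inv_mult_cancel [simp]: "inverse x * (x * y) = y"
  by (simp flip: mult.assoc)

lemma right_inv [simp]: "x * inverse x = 1"
  by (metis inv_mult_cancel left_inv mult.assoc mult_1_right)

lemma mult_inv_cancel [simp]: "x * (inverse x * y) = y"
  by (simp flip: mult.assoc)

lemma inv_unique: "x * y = 1 \<Longrightarrow> inverse x = y"
  by (metis inv_mult_cancel mult_1_right)

lemma inv_inv [simp]: "inverse (inverse x) = x"
  by (simp add: inv_unique)

lemma inv_one [simp]: "inverse 1 = 1"
  by (simp add: inv_unique)

lemma inv_mult [simp]: "inverse (x * y) = inverse y * inverse x"
  by (rule inv_unique) (simp add: mult.assoc)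

definition comm :: "'a \<Rightarrow> 'a \<Rightarrow> 'a" where
  "comm g x = g * x * inverse g * inverse x"

definition is_subgroup :: "'a set \<Rightarrow> bool" where
  "is_subgroup H \<longleftrightarrow> 1 \<in> H \<and> (\<forall>x\<in>H. \<forall>y\<in>H. x * y \<in> H) \<and> (\<forall>x\<in>H. inverse x \<in> H)"

definition normal_in :: "'a set \<Rightarrow> 'a set \<Rightarrow> bool" where
  "normal_in G N \<longleftrightarrow> is_subgroup N \<and> N \<subseteq> G \<and> (\<forall>g\<in>G. \<forall>x\<in>N. g * x * inverse g \<in> N)"

text \<open>The subgroup generated by \<open>x\<close> and \<open>N\<close>, in the only situation in which it occurs: \<open>x\<close> normalises
  the subgroup \<open>N\<close> and \<open>x\<^sup>2\<close> lies in \<open>N\<close>.\<close>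

definition adjoin :: "'a \<Rightarrow> 'a set \<Rightarrow> 'a set" where
  "adjoin x N = N \<union> (\<lambda>n. x * n) ` N"

text \<open>The preimage of the centre of \<open>G/N\<close>.\<close>

definition central_mod :: "'a set \<Rightarrow> 'a set \<Rightarrow> 'a set" where
  "central_mod G N = {x\<in>G. \<forall>g\<in>G. comm g x \<in> N}"

definition finite_index :: "'a set \<Rightarrow> 'a set \<Rightarrow> bool" where
  "finite_index G N \<longleftrightarrow> (\<exists>F. finite F \<and> F \<subseteq> G \<and> (\<forall>g\<in>G. \<exists>f\<in>F. \<exists>n\<in>N. g = f * n))"

lemma is_subgroup_D:
  assumes "is_subgroup H"
  shows "1 \<in> H" "x \<in> H \<Longrightarrow> y \<in> H \<Longrightarrow> x * y \<in> H" "x \<in> H \<Longrightarrow> inverse x \<in> H"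
  using assms by (auto simp: is_subgroup_def)

lemma normal_in_D:
  assumes "normal_in G N"
  shows "is_subgroup N" "N \<subseteq> G" "g \<in> G \<Longrightarrow> x \<in> N \<Longrightarrow> g * x * inverse g \<in> N"
  using assms by (auto simp: normal_in_def)

lemma normal_in_conj': "is_subgroup G \<Longrightarrow> normal_in G N \<Longrightarrow> g \<in> G \<Longrightarrow> x \<in> N \<Longrightarrow> inverse g * x * g \<in> N"
  using normal_in_D(3)[of G N "inverse g" x] is_subgroup_D(3)[of G g] by simp

lemma comm_mult_left: "comm (g * h) x = g * comm h x * inverse g * comm g x"
  by (simp add: comm_def mult.assoc)

lemma comm_mult_right: "comm g (x * y) = comm g x * (x * comm g y * inverse x)"
  by (simp add: comm_def mult.assoc)

text \<open>Being the preimage of a normal subgroup of the quotient, \<open>central_mod\<close> is normal itself. This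
  reduces statements \<open>[G, H] \<le> N\<close> to generators of \<open>H\<close>.\<close>

lemma normal_in_central_mod:
  assumes G: "is_subgroup G" and N: "normal_in G N"
  shows "normal_in G (central_mod G N)"
  unfolding normal_in_def is_subgroup_def
proof (intro conjI ballI)
  note [simp] = is_subgroup_D[OF G] is_subgroup_D[OF normal_in_D(1)[OF N]] normal_in_D(3)[OF N]
  show "1 \<in> central_mod G N" by (simp add: central_mod_def comm_def)
  show sub: "central_mod G N \<subseteq> G" by (auto simp: central_mod_def)
  fix x assume x: "x \<in> central_mod G N"
  then have xG: "x \<in> G" and xc: "\<And>g. g \<in> G \<Longrightarrow> comm g x \<in> N" by (auto simp: central_mod_def)
  show "inverse x \<in> central_mod G N"
  proof -
    \<comment> \<open>The double inverse is kept so that the right side has the shape of a conjugate.\<close>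
    have "comm g (inverse x) = inverse x * inverse (comm g x) * inverse (inverse x)" for g
      by (simp add: comm_def mult.assoc)
    then show ?thesis using xG xc normal_in_D(3)[OF N, of "inverse x"] by (simp add: central_mod_def del: inv_inv)
  qed
  fix y assume y: "y \<in> central_mod G N"
  show "x * y \<in> central_mod G N"
    using x y by (simp add: central_mod_def comm_mult_right)
next
  fix g x assume g: "g \<in> G" and x: "x \<in> central_mod G N"
  note [simp] = is_subgroup_D[OF G] is_subgroup_D[OF normal_in_D(1)[OF N]] normal_in_D(3)[OF N]
  have NG: "\<And>n. n \<in> N \<Longrightarrow> n \<in> G" using N by (auto simp: normal_in_def)
  have xG: "x \<in> G" and xc: "\<And>g. g \<in> G \<Longrightarrow> comm g x \<in> N" using x by (auto simp: central_mod_def)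
  have "comm h (comm g x) \<in> N" if "h \<in> G" for h
    using that xc[OF g] by (simp add: comm_def[of h] del: inv_mult)
  moreover have "g * x * inverse g = comm g x * x" by (simp add: comm_def mult.assoc)
  ultimately show "g * x * inverse g \<in> central_mod G N"
    using xc[OF g] x NG xG by (simp add: central_mod_def comm_mult_right)
qed

text \<open>Modulo \<open>N\<close>, the element \<open>x\<close> is central of order at most two. Adjoining one such element at a
  time builds all the finite quotients that are needed.\<close>

lemma normal_in_adjoin:
  assumes G: "is_subgroup G" and N: "normal_in G N" and x: "x \<in> central_mod G N" and sq: "x * x \<in> N"
  shows "normal_in G (adjoin x N)"
proof -
  note [simp] = is_subgroup_D[OF G] is_subgroup_D[OF normal_in_D(1)[OF N]] normal_in_D(3)[OF N]
  have NG: "\<And>n. n \<in> N \<Longrightarrow> n \<in> G" using N by (auto simp: normal_in_def)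
  have xG: "x \<in> G" and xc: "\<And>g. g \<in> G \<Longrightarrow> comm g x \<in> N" using x by (auto simp: central_mod_def)
  have conj: "inverse x * n * x \<in> N" if "n \<in> N" for n
    using normal_in_conj'[OF G N xG that] .
  have memI: "y \<in> adjoin x N" if "inverse x * y \<in> N" for y
    using that by (force simp: adjoin_def intro: image_eqI[of _ _ "inverse x * y"])
  have N_adjoin: "y \<in> adjoin x N" if "y \<in> N" for y using that by (simp add: adjoin_def)
  show ?thesis
    unfolding normal_in_def is_subgroup_def
  proof (intro conjI ballI)
    show "1 \<in> adjoin x N" "adjoin x N \<subseteq> G" using NG xG by (auto simp: adjoin_def)
  next
    fix u v assume "u \<in> adjoin x N" "v \<in> adjoin x N"
    then consider "u \<in> N" "v \<in> N" | n where "u = x * n" "n \<in> N" "v \<in> N"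
      | n where "v = x * n" "n \<in> N" "u \<in> N"
      | m n where "u = x * m" "v = x * n" "m \<in> N" "n \<in> N"
      by (auto simp: adjoin_def)
    then show "u * v \<in> adjoin x N"
    proof cases
      case 1
      then show ?thesis by (simp add: N_adjoin)
    next
      case 2
      then show ?thesis by (intro memI) (simp add: mult.assoc)
    next
      case 3
      then have "inverse x * u * x * n \<in> N" using conj by simp
      then show ?thesis using 3 by (intro memI) (simp add: mult.assoc)
    next
      case 4
      then have "x * x * (inverse x * m * x) * n \<in> N" using conj sq by simp
      then show ?thesis using 4 by (intro N_adjoin) (simp add: mult.assoc)
    qed
  next
    fix u assume "u \<in> adjoin x N"
    then consider "u \<in> N" | n where "u = x * n" "n \<in> N" by (auto simp: adjoin_def)
    then show "inverse u \<in> adjoin x N"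
    proof cases
      case 2
      then have "inverse x * inverse n * x * inverse (x * x) \<in> N"
        using conj sq by (simp del: inv_mult)
      then show ?thesis using 2 by (intro memI) (simp add: mult.assoc)
    qed (auto intro!: N_adjoin)
  next
    fix g u assume g: "g \<in> G" and "u \<in> adjoin x N"
    then consider "u \<in> N" | n where "u = x * n" "n \<in> N" by (auto simp: adjoin_def)
    then show "g * u * inverse g \<in> adjoin x N"
    proof cases
      case 1
      then show ?thesis using g by (simp add: N_adjoin)
    next
      case 2
      then have "inverse x * comm g x * x * (g * n * inverse g) \<in> N" using conj xc g by simp
      then show ?thesis using 2 by (intro memI) (simp add: mult.assoc comm_def)
    qed
  qed
qed

lemma finite_index_adjoin:
  assumes "is_subgroup G" "x \<in> G" "finite_index G (adjoin x N)"
  shows "finite_index G N"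
proof -
  obtain F where F: "finite F" "F \<subseteq> G" "\<And>g. g \<in> G \<Longrightarrow> \<exists>f\<in>F. \<exists>n\<in>adjoin x N. g = f * n"
    using assms(3) unfolding finite_index_def by blast
  let ?F = "F \<union> (\<lambda>f. f * x) ` F"
  have "\<exists>f\<in>?F. \<exists>n\<in>N. g = f * n" if "g \<in> G" for g
    using F(3)[OF that] by (auto simp: adjoin_def mult.assoc[symmetric]) blast+
  moreover have "?F \<subseteq> G" using F(2) assms(1,2) by (auto simp: is_subgroup_def)
  moreover have "finite ?F" using F(1) by simp
  ultimately show ?thesis unfolding finite_index_def by blast
qed

end

section \<open>Tree automorphisms and their sections\<close>

typedef tree_auto = "carrier tree_aut"
  morphisms act Abs_tree_auto
  using group.is_monoid[OF group_tree_aut] monoid.one_closed by blast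

lemma act_tree_aut [simp]: "act x \<in> carrier tree_aut"
  by (rule act)

lemma bij_act: "bij (act x)" and prefix_act: "prefix (act x u) (act x v) \<longleftrightarrow> prefix u v"
  using act_tree_aut[of x] by (auto simp: carrier_tree_aut)

instantiation tree_auto :: mult_group
begin

definition one_tree_auto :: tree_auto where "1 = Abs_tree_auto id"
definition times_tree_auto :: "tree_auto \<Rightarrow> tree_auto \<Rightarrow> tree_auto" where
  "x * y = Abs_tree_auto (act x \<circ> act y)"
definition inverse_tree_auto :: "tree_auto \<Rightarrow> tree_auto" where
  "inverse x = Abs_tree_auto (inv_into UNIV (act x))"
definition divide_tree_auto :: "tree_auto \<Rightarrow> tree_auto \<Rightarrow> tree_auto" where
  "divide_tree_auto x y = x * inverse y"

lemma act_one [simp]: "act 1 = id"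
  unfolding one_tree_auto_def
  by (rule Abs_tree_auto_inverse) (simp add: carrier_tree_aut)

lemma act_mult [simp]: "act (x * y) = act x \<circ> act y"
  unfolding times_tree_auto_def
  by (rule Abs_tree_auto_inverse) (auto simp: carrier_tree_aut prefix_act intro: bij_comp bij_act)

lemma act_inverse: "act (inverse x) = inv_into UNIV (act x)"
  unfolding inverse_tree_auto_def
proof (rule Abs_tree_auto_inverse)
  have "prefix (inv_into UNIV (act x) u) (inv_into UNIV (act x) v) \<longleftrightarrow> prefix u v" for u v
    by (metis bij_act bij_inv_eq_iff prefix_act)
  then show "inv_into UNIV (act x) \<in> carrier tree_aut"
    by (simp add: carrier_tree_aut bij_act bij_imp_bij_inv)
qed

instance
proof
  show "x * y * z = x * (y * z)" for x y z :: tree_auto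
    by (simp add: act_inject[symmetric] comp_assoc)
  show "inverse x * x = 1" for x :: tree_auto
    by (simp add: act_inject[symmetric] act_inverse bij_act bij_is_inj)
qed (simp_all add: act_inject[symmetric])

end

fun pair_fun :: "(vertex \<Rightarrow> vertex) \<Rightarrow> (vertex \<Rightarrow> vertex) \<Rightarrow> vertex \<Rightarrow> vertex" where
  "pair_fun f g [] = []"
| "pair_fun f g (False # w) = False # f w"
| "pair_fun f g (True # w) = True # g w"

text \<open>The element of the stabiliser of the first level with sections \<open>x\<close> below 0 and \<open>y\<close> below 1.\<close>

definition pair :: "tree_auto \<Rightarrow> tree_auto \<Rightarrow> tree_auto" where
  "pair x y = Abs_tree_auto (pair_fun (act x) (act y))"

text \<open>Bijectivity holds because the pair of the inverses is an inverse.\<close>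

lemma act_pair: "act (pair x y) = pair_fun (act x) (act y)"
  unfolding pair_def
proof (rule Abs_tree_auto_inverse)
  have inv: "pair_fun (act x) (act y) (pair_fun (act (inverse x)) (act (inverse y)) w) = w" for x y w
    by (cases w rule: grig_a.cases)
      (simp_all add: act_inverse bij_act bij_is_surj surj_f_inv_f)
  have "pair_fun (act (inverse x)) (act (inverse y)) (pair_fun (act x) (act y) w) = w" for w
    using inv[of "inverse x" "inverse y" w] by simp
  then have "bij (pair_fun (act x) (act y))"
    using inv[of x y] by (intro o_bij[of "pair_fun (act (inverse x)) (act (inverse y))"]) auto
  moreover have "prefix (pair_fun (act x) (act y) u) (pair_fun (act x) (act y) v) \<longleftrightarrow> prefix u v"
    for u v
    by (cases "(act x, act y, u)" rule: pair_fun.cases; cases "(act x, act y, v)" rule: pair_fun.cases)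
      (simp_all add: prefix_act)
  ultimately show "pair_fun (act x) (act y) \<in> carrier tree_aut"
    by (simp add: carrier_tree_aut)
qed

lemma tree_auto_eqI: "(\<And>w. act x w = act y w) \<Longrightarrow> x = y"
  by (simp add: act_inject[symmetric] fun_eq_iff)

lemma pair_mult [simp]: "pair x y * pair x' y' = pair (x * x') (y * y')"
proof (rule tree_auto_eqI)
  fix w show "act (pair x y * pair x' y') w = act (pair (x * x') (y * y')) w"
    by (cases w rule: grig_a.cases) (simp_all add: act_pair)
qed

lemma pair_one: "pair 1 1 = 1"
proof (rule tree_auto_eqI)
  fix w show "act (pair 1 1) w = act 1 w" by (cases w rule: grig_a.cases) (simp_all add: act_pair)
qed

lemma pair_inverse [simp]: "inverse (pair x y) = pair (inverse x) (inverse y)"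
  by (rule inv_unique) (simp add: pair_one)

lemma pair_mult_assoc [simp]: "pair x y * (pair x' y' * z) = pair (x * x') (y * y') * z"
  by (simp flip: mult.assoc)

lemma pair_eq_iff [simp]: "pair x y = pair x' y' \<longleftrightarrow> x = x' \<and> y = y'"
proof
  assume eq: "pair x y = pair x' y'"
  have "act x w = act x' w" "act y w = act y' w" for w
    using arg_cong[OF eq, of "\<lambda>z. act z (False # w)"] arg_cong[OF eq, of "\<lambda>z. act z (True # w)"]
    by (simp_all add: act_pair)
  then show "x = x' \<and> y = y'" by (auto intro: tree_auto_eqI)
qed simp

lemma comm_pair [simp]: "comm (pair x y) (pair x' y') = pair (comm x x') (comm y y')"
  by (simp add: comm_def)

section \<open>The generators and their relations\<close>

text \<open>Identities between words in the generators are proved by computing sections: \<open>gb\<close>, \<open>gc\<close> and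
  \<open>gd\<close> are pairs, and \<open>ga\<close> swaps the two entries of a pair.\<close>

definition ga :: tree_auto where "ga = Abs_tree_auto grig_a"
definition gb :: tree_auto where "gb = Abs_tree_auto grig_b"
definition gc :: tree_auto where "gc = Abs_tree_auto grig_c"
definition gd :: tree_auto where "gd = Abs_tree_auto grig_d"

lemma act_gens: "act ga = grig_a" "act gb = grig_b" "act gc = grig_c" "act gd = grig_d"
  using grig_generators_tree_aut by (auto simp: ga_def gb_def gc_def gd_def intro!: Abs_tree_auto_inverse)

lemma gen_sq [simp]: "ga * ga = 1" "gb * gb = 1" "gc * gc = 1" "gd * gd = 1"
  by (auto intro!: tree_auto_eqI simp: act_gens grig_involution)

lemma gen_sq_assoc [simp]: "ga * (ga * x) = x" "gb * (gb * x) = x" "gc * (gc * x) = x" "gd * (gd * x) = x"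
  by (simp_all flip: mult.assoc)

lemma gen_inverse [simp]: "inverse ga = ga" "inverse gb = gb" "inverse gc = gc" "inverse gd = gd"
  by (simp_all add: inv_unique)

lemma gb_pair: "gb = pair ga gc" and gc_pair: "gc = pair ga gd" and gd_pair: "gd = pair 1 gb"
proof -
  have "act gb w = act (pair ga gc) w" "act gc w = act (pair ga gd) w" "act gd w = act (pair 1 gb) w" for w
    by (cases w rule: grig_a.cases; simp add: act_pair act_gens)+
  then show "gb = pair ga gc" "gc = pair ga gd" "gd = pair 1 gb" by (auto intro: tree_auto_eqI)
qed

lemma ga_pair: "ga * pair x y = pair y x * ga"
proof (rule tree_auto_eqI)
  fix w show "act (ga * pair x y) w = act (pair y x * ga) w"
    by (cases w rule: grig_a.cases) (simp_all add: act_pair act_gens)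
qed

lemma ga_pair_assoc: "ga * (pair x y * z) = pair y x * (ga * z)"
  by (simp add: ga_pair flip: mult.assoc)

lemma gen_mult [simp]:
  "gb * gc = gd" "gc * gd = gb" "gd * gb = gc" "gc * gb = gd" "gd * gc = gb" "gb * gd = gc"
proof -
  have "grig_b (grig_c w) = grig_d w \<and> grig_c (grig_d w) = grig_b w \<and> grig_d (grig_b w) = grig_c w" for w
  proof (induction w)
    case (Cons x w)
    then show ?case by (cases x) (simp_all add: grig_involution)
  qed simp
  then show *: "gb * gc = gd" "gc * gd = gb" "gd * gb = gc"
    by (auto intro!: tree_auto_eqI simp: act_gens)
  show "gc * gb = gd" "gd * gc = gb" "gb * gd = gc"
    using *[THEN arg_cong, of inverse] by simp_all
qed

lemma gen_mult_assoc [simp]: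
  "gb * (gc * x) = gd * x" "gc * (gd * x) = gb * x" "gd * (gb * x) = gc * x"
  "gc * (gb * x) = gd * x" "gd * (gc * x) = gb * x" "gb * (gd * x) = gc * x"
  by (simp_all flip: mult.assoc)

text \<open>Since \<open>c = bd\<close> and the generators are involutions, the products of \<open>a\<close>, \<open>b\<close> and \<open>d\<close> already
  form the whole group. The three letters keep later inductions short.\<close>

inductive_set Grig :: "tree_auto set" where
  Grig_one: "1 \<in> Grig"
| Grig_step: "s \<in> {ga, gb, gd} \<Longrightarrow> g \<in> Grig \<Longrightarrow> s * g \<in> Grig"

lemma is_subgroup_Grig: "is_subgroup Grig"
proof -
  have mult: "x * y \<in> Grig" if "x \<in> Grig" "y \<in> Grig" for x y
    using that by (induction x rule: Grig.induct) (auto simp: mult.assoc intro: Grig.intros)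
  have gen: "s \<in> Grig" if "s \<in> {ga, gb, gd}" for s
    using Grig_step[OF that Grig_one] by simp
  have "inverse x \<in> Grig" if "x \<in> Grig" for x
    using that
  proof (induction x rule: Grig.induct)
    case (Grig_step s g)
    then have "inverse g * s \<in> Grig" using mult gen by blast
    then show ?case using Grig_step by auto
  qed (simp add: Grig.intros)
  then show ?thesis using mult by (simp add: is_subgroup_def Grig_one)
qed

lemmas Grig_D [simp] = is_subgroup_D[OF is_subgroup_Grig]

lemma Grig_gens [simp]: "ga \<in> Grig" "gb \<in> Grig" "gc \<in> Grig" "gd \<in> Grig"
proof -
  have gen: "s \<in> Grig" if "s \<in> {ga, gb, gd}" for s
    using Grig_step[OF that Grig_one] by simp
  then show "ga \<in> Grig" "gb \<in> Grig" "gd \<in> Grig" by auto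
  then have "gb * gd \<in> Grig" by (intro Grig_D)
  then show "gc \<in> Grig" by simp
qed

lemma normal_in_gensI:
  assumes "is_subgroup N" "N \<subseteq> Grig"
    "\<And>x. x \<in> N \<Longrightarrow> ga * x * ga \<in> N" "\<And>x. x \<in> N \<Longrightarrow> gb * x * gb \<in> N" "\<And>x. x \<in> N \<Longrightarrow> gd * x * gd \<in> N"
  shows "normal_in Grig N"
proof -
  have "\<forall>x\<in>N. g * x * inverse g \<in> N" if "g \<in> Grig" for g
    using that
  proof (induction g rule: Grig.induct)
    case (Grig_step s g)
    then have "\<forall>x\<in>N. s * (g * x * inverse g) * s \<in> N" using assms(3-5) by auto
    then show ?case using Grig_step(1) by (auto simp: mult.assoc)
  qed simp
  then show ?thesis using assms(1,2) by (simp add: normal_in_def)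
qed

lemma central_gensI:
  assumes N: "normal_in Grig N" and x: "x \<in> Grig" "comm ga x \<in> N" "comm gb x \<in> N" "comm gd x \<in> N"
  shows "x \<in> central_mod Grig N"
proof -
  have "comm g x \<in> N" if "g \<in> Grig" for g
    using that
  proof (induction g rule: Grig.induct)
    case Grig_one
    then show ?case using is_subgroup_D(1)[OF normal_in_D(1)[OF N]] by (simp add: comm_def)
  next
    case (Grig_step s g)
    then have "s \<in> Grig" "comm s x \<in> N" using x by auto
    then show ?case
      using Grig_step(3) normal_in_D(3)[OF N] is_subgroup_D(2)[OF normal_in_D(1)[OF N]] by (simp add: comm_mult_left)
  qed
  then show ?thesis using x by (simp add: central_mod_def)
qed

section \<open>The branching subgroup\<close>

definition gt :: tree_auto where "gt = ga * gb * ga * gb"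

lemma gt_pair: "gt = pair (gc * ga) (ga * gc)"
proof -
  have "gt = ga * pair ga gc * ga * pair ga gc" by (simp add: gt_def flip: gb_pair)
  also have "\<dots> = pair (gc * ga) (ga * gc)" by (simp add: ga_pair ga_pair_assoc mult.assoc)
  finally show ?thesis .
qed

lemma gt_Grig [simp]: "gt \<in> Grig"
  unfolding gt_def by (intro Grig_D Grig_gens)

text \<open>The normal closure of \<open>t\<close>.\<close>

inductive_set Kgrp :: "tree_auto set" where
  K_one: "1 \<in> Kgrp"
| K_gt: "gt \<in> Kgrp"
| K_mult: "x \<in> Kgrp \<Longrightarrow> y \<in> Kgrp \<Longrightarrow> x * y \<in> Kgrp"
| K_inv: "x \<in> Kgrp \<Longrightarrow> inverse x \<in> Kgrp"
| K_conj: "x \<in> Kgrp \<Longrightarrow> s \<in> {ga, gb, gd} \<Longrightarrow> s * x * s \<in> Kgrp"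

lemma normal_in_K: "normal_in Grig Kgrp"
proof (rule normal_in_gensI)
  show "is_subgroup Kgrp" by (auto simp: is_subgroup_def intro: Kgrp.intros)
  show "Kgrp \<subseteq> Grig"
  proof
    fix x assume "x \<in> Kgrp"
    then show "x \<in> Grig" by (induction rule: Kgrp.induct) auto
  qed
qed (simp_all add: K_conj)

lemmas K_D [simp] = is_subgroup_D[OF normal_in_D(1)[OF normal_in_K]]
  subsetD[OF normal_in_D(2)[OF normal_in_K]] K_gt
  normal_in_D(3)[OF normal_in_K]

lemma conj_pair:
  "ga * pair x y * ga = pair y x"
  "gb * pair x y * gb = pair (ga * x * ga) (gc * y * gc)"
  "gc * pair x y * gc = pair (ga * x * ga) (gd * y * gd)"
  "gd * pair x y * gd = pair x (gb * y * gb)"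
proof -
  show "ga * pair x y * ga = pair y x" by (simp add: ga_pair mult.assoc)
  show "gb * pair x y * gb = pair (ga * x * ga) (gc * y * gc)"
    using arg_cong[OF gb_pair, of "\<lambda>z. z * pair x y * z"] by simp
  show "gc * pair x y * gc = pair (ga * x * ga) (gd * y * gd)"
    using arg_cong[OF gc_pair, of "\<lambda>z. z * pair x y * z"] by simp
  show "gd * pair x y * gd = pair x (gb * y * gb)"
    using arg_cong[OF gd_pair, of "\<lambda>z. z * pair x y * z"] by simp
qed

lemma ada_pair: "ga * gd * ga = pair gb 1" "ga * gb * ga = pair gc ga" "ga * gc * ga = pair gd ga"
  by (subst gd_pair gb_pair gc_pair, simp add: conj_pair)+

text \<open>Modulo \<open>K \<times> K\<close> the generator \<open>d\<close> commutes with \<open>t\<close>, while \<open>a\<close> and \<open>b\<close> invert \<open>t\<close> exactly.\<close>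

lemma dtd: "gd * gt * gd = pair 1 (inverse gt) * gt"
proof -
  have "gd * gt * gd = pair (gc * ga) (gb * (ga * gc) * gb)" by (simp add: gt_pair conj_pair)
  also have "\<dots> = pair 1 (inverse gt) * pair (gc * ga) (ga * gc)"
    by (simp add: gt_def mult.assoc)
  finally show ?thesis by (simp flip: gt_pair)
qed

text \<open>The elements \<open>ca\<close> and \<open>ac\<close> are the sections of \<open>t\<close>, so these identities govern commutators
  with \<open>t\<close> one level higher. They also produce the first elements of \<open>K\<close> of the form \<open>(x, 1)\<close>.\<close>

lemma comm_ac_gt: "comm (gc * ga) gt = pair 1 (inverse gt)" "comm (ga * gc) gt = pair (gd * gt * gd) 1"
proof -
  have "comm (gc * ga) gt = gc * (ga * gt * ga) * gc * inverse gt" by (simp add: comm_def mult.assoc)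
  also have "\<dots> = pair (ga * (ga * gc) * ga) (gd * (gc * ga) * gd) * pair (ga * gc) (gc * ga)"
    by (simp add: gt_pair conj_pair)
  also have "\<dots> = pair 1 (inverse gt)" by (simp add: gt_def mult.assoc)
  finally show "comm (gc * ga) gt = pair 1 (inverse gt)" .
  have "comm (ga * gc) gt = ga * (gc * gt * gc) * ga * inverse gt" by (simp add: comm_def mult.assoc)
  also have "\<dots> = pair (gd * (ga * gc) * gd) (ga * (gc * ga) * ga) * pair (ga * gc) (gc * ga)"
    by (simp add: gt_pair conj_pair)
  also have "\<dots> = pair (gd * gt * gd) 1" by (simp add: gt_def mult.assoc)
  finally show "comm (ga * gc) gt = pair (gd * gt * gd) 1" .
qed

text \<open>Conjugating by \<open>aca = (d, a)\<close> turns \<open>(d t d, 1) = [ac, t]\<close> into \<open>(t, 1)\<close>. The property passes to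
  conjugates because each of \<open>a\<close>, \<open>b\<close>, \<open>d\<close> is the first section of an element of \<open>G\<close> that fixes the
  first level.\<close>

lemma pair_K_left: "x \<in> Kgrp \<Longrightarrow> pair x 1 \<in> Kgrp"
proof (induction rule: Kgrp.induct)
  case K_one
  then show ?case by (simp add: pair_one)
next
  case K_gt
  have "comm (ga * gc) gt \<in> Kgrp" unfolding comm_def by (intro K_D Grig_D Grig_gens)
  then have "ga * gc * ga * pair (gd * gt * gd) 1 * inverse (ga * gc * ga) \<in> Kgrp"
    unfolding comm_ac_gt by (intro K_D(6)) simp_all
  then show ?case unfolding ada_pair by (simp add: mult.assoc)
next
  case (K_mult x y)
  then have "pair x 1 * pair y 1 \<in> Kgrp" by (intro K_D)
  then show ?case by simp
next
  case (K_inv x)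
  then have "inverse (pair x 1) \<in> Kgrp" by (intro K_D)
  then show ?case by simp
next
  case (K_conj x s)
  have "pair gb 1 \<in> Grig" "pair ga gc \<in> Grig" "pair gd ga \<in> Grig"
    by (simp_all flip: ada_pair gb_pair)
  then obtain z where "pair s z \<in> Grig" using K_conj(2) by blast
  then have "pair s z * pair x 1 * inverse (pair s z) \<in> Kgrp" using K_conj by (intro K_D(6))
  moreover have "inverse s = s" using K_conj by auto
  ultimately show ?case by (simp add: mult.assoc)
qed

lemma pair_K: "x \<in> Kgrp \<Longrightarrow> y \<in> Kgrp \<Longrightarrow> pair x y \<in> Kgrp"
proof -
  assume x: "x \<in> Kgrp" and y: "y \<in> Kgrp"
  have "pair x 1 * (ga * pair y 1 * inverse ga) \<in> Kgrp"
    using pair_K_left[OF x] pair_K_left[OF y] by (intro K_D Grig_gens)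
  then show ?thesis by (simp add: conj_pair)
qed

text \<open>This allows the relations \<open>[G, M] \<le> L\<close> and \<open>[G, L] \<le> M \<times> M\<close> to be applied in both coordinates:
  they give \<open>[K, M \<times> M] \<le> L \<times> L\<close> and so on.\<close>

lemma K_sections:
  assumes "k \<in> Kgrp"
  obtains g h where "g \<in> Grig" "h \<in> Grig" "k = pair g h"
proof -
  have "\<exists>g\<in>Grig. \<exists>h\<in>Grig. k = pair g h"
    using assms
  proof (induction rule: Kgrp.induct)
    case K_one
    then show ?case by (metis pair_one Grig_D(1))
  next
    case K_gt
    then show ?case using gt_pair by (metis Grig_D(2) Grig_gens)
  next
    case (K_mult x y)
    then show ?case by (metis Grig_D(2) pair_mult)
  next
    case (K_inv x)
    then show ?case by (metis Grig_D(3) pair_inverse)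
  next
    case (K_conj x s)
    then obtain g h where gh: "g \<in> Grig" "h \<in> Grig" "x = pair g h" by blast
    have "s * x * s \<in> {pair h g, pair (ga * g * ga) (gc * h * gc), pair g (gb * h * gb)}"
      using K_conj(2) by (auto simp: gh conj_pair)
    then show ?case using gh(1,2) by auto
  qed
  then show ?thesis using that by blast
qed

text \<open>The iterate \<open>pairs ^^ j\<close> places a copy of \<open>A\<close> at every vertex of level \<open>j\<close>.\<close>

definition pairs :: "tree_auto set \<Rightarrow> tree_auto set" where
  "pairs A = {pair x y | x y. x \<in> A \<and> y \<in> A}"

lemma pairs_pair [simp]: "pair x y \<in> pairs A \<longleftrightarrow> x \<in> A \<and> y \<in> A"
  by (auto simp: pairs_def)

lemma pairsE:
  assumes "z \<in> pairs A"
  obtains x y where "z = pair x y" "x \<in> A" "y \<in> A"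
  using assms by (auto simp: pairs_def)

lemma is_subgroup_pairs: "is_subgroup A \<Longrightarrow> is_subgroup (pairs A)"
  by (auto simp: is_subgroup_def pairs_def) (metis pair_one)

lemma normal_in_pairs:
  assumes N: "normal_in Grig N" and sub: "N \<subseteq> Kgrp"
  shows "normal_in Grig (pairs N)"
proof (rule normal_in_gensI)
  show "is_subgroup (pairs N)" using is_subgroup_pairs normal_in_D(1)[OF N] .
  show "pairs N \<subseteq> Grig" using sub by (auto simp: pairs_def intro!: K_D(4) pair_K)
  have conj: "s * x * s \<in> N" if "s \<in> {ga, gb, gc, gd}" "x \<in> N" for s x
    using normal_in_D(3)[OF N, of s x] that by auto
  fix x assume "x \<in> pairs N"
  then obtain u v where x: "x = pair u v" "u \<in> N" "v \<in> N" by (rule pairsE)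
  show "ga * x * ga \<in> pairs N" "gb * x * gb \<in> pairs N" "gd * x * gd \<in> pairs N"
    using x by (simp_all add: conj_pair conj)
qed

lemma da_sq_pair: "(gd * ga) * (gd * ga) = pair gb gb"
proof -
  have "(gd * ga) * (gd * ga) = gd * (ga * gd * ga)" by (simp add: mult.assoc)
  also have "\<dots> = pair 1 gb * pair gb 1" by (simp add: ada_pair gd_pair[symmetric])
  finally show ?thesis by simp
qed

text \<open>The element \<open>(da)\<^sup>2 = (b, b)\<close> is an involution, and \<open>(ca)\<^sup>2\<close> differs from it by the conjugate
  \<open>c t c\<close>. So \<open>(ca)\<^sup>4\<close> is a product of two conjugates of \<open>t\<close>.\<close>

lemma gca_4: "(gc * ga) * (gc * ga) * (gc * ga) * (gc * ga) \<in> Kgrp"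
  and gda_4: "(gd * ga) * (gd * ga) * (gd * ga) * (gd * ga) = 1"
proof -
  define u where "u = (gd * ga) * (gd * ga)"
  define v where "v = (gc * ga) * (gc * ga)"
  have "u = pair gb gb" unfolding u_def by (rule da_sq_pair)
  then have uu: "u * u = 1" by (simp add: pair_one)
  then show "(gd * ga) * (gd * ga) * (gd * ga) * (gd * ga) = 1"
    by (simp add: u_def mult.assoc)
  have [simp]: "u \<in> Grig" by (simp add: u_def)
  have "v = (gc * gt * inverse gc) * u"
    by (simp add: v_def u_def gt_def mult.assoc)
  then have "v * v = (gc * gt * inverse gc) * (u * (gc * gt * inverse gc) * inverse u)"
    using inv_unique[OF uu] by (simp add: mult.assoc)
  also have "\<dots> \<in> Kgrp" by (intro K_D(2,6)) simp_all
  finally show "(gc * ga) * (gc * ga) * (gc * ga) * (gc * ga) \<in> Kgrp"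
    by (simp add: v_def mult.assoc)
qed

section \<open>Subgroups with central quotients\<close>

abbreviation K1 :: "tree_auto set" where "K1 \<equiv> pairs Kgrp"

definition Mgrp :: "tree_auto set" where "Mgrp = adjoin (gt * gt) K1"

text \<open>This is \<open>\<langle>(t, t), M \<times> M\<rangle>\<close>. As \<open>K/M\<close> has order at most two, a pair over \<open>K\<close> lies in that subgroup
  exactly if its entries have the same class modulo \<open>M\<close>.\<close>

definition Lgrp :: "tree_auto set" where
  "Lgrp = {pair x y | x y. x \<in> Kgrp \<and> y \<in> Kgrp \<and> (x \<in> Mgrp \<longleftrightarrow> y \<in> Mgrp)}"

abbreviation M1 :: "tree_auto set" where "M1 \<equiv> pairs Mgrp"

lemma normal_in_K1: "normal_in Grig K1"
  using normal_in_pairs[OF normal_in_K] by simp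

lemma gt_4_pair: "gt * gt * (gt * gt) =
    pair ((gc * ga) * (gc * ga) * (gc * ga) * (gc * ga))
      (inverse ((gc * ga) * (gc * ga) * (gc * ga) * (gc * ga)))"
  by (simp add: gt_pair mult.assoc)

lemma gt_4_K1: "gt * gt * (gt * gt) \<in> K1"
  using gca_4 K_D(3)[OF gca_4] unfolding gt_4_pair pairs_pair by blast

lemma comm_gen_gt_sq:
  "comm ga (gt * gt) = inverse (gt * gt * (gt * gt))"
  "comm gb (gt * gt) = inverse (gt * gt * (gt * gt))"
  "comm gd (gt * gt) = pair 1 (inverse gt * (ga * gc * inverse gt * inverse (ga * gc)))"
proof -
  show "comm ga (gt * gt) = inverse (gt * gt * (gt * gt))"
    "comm gb (gt * gt) = inverse (gt * gt * (gt * gt))"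
    by (simp_all add: comm_def gt_def mult.assoc)
  have "comm gd (gt * gt) = (gd * gt * gd) * (gd * gt * gd) * inverse (gt * gt)"
    by (simp add: comm_def mult.assoc)
  also have "\<dots> = pair 1 (inverse gt) * (gt * pair 1 (inverse gt) * inverse gt)"
    unfolding dtd by (simp add: mult.assoc)
  also have "gt * pair 1 (inverse gt) * inverse gt
      = pair 1 (ga * gc * inverse gt * inverse (ga * gc))"
    by (subst gt_pair, subst (2) gt_pair) (simp add: mult.assoc)
  finally show "comm gd (gt * gt) = pair 1 (inverse gt * (ga * gc * inverse gt * inverse (ga * gc)))"
    by simp
qed

text \<open>The element \<open>t\<^sup>2\<close> is central modulo \<open>K \<times> K\<close>, and \<open>t\<^sup>4\<close> lies in \<open>K \<times> K\<close> because its sections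
  \<open>(ca)\<^sup>4\<close> and \<open>(ac)\<^sup>4\<close> lie in \<open>K\<close>.\<close>

lemma normal_in_M: "normal_in Grig Mgrp"
  unfolding Mgrp_def
proof (rule normal_in_adjoin[OF is_subgroup_Grig normal_in_K1])
  note K1 = is_subgroup_D[OF normal_in_D(1)[OF normal_in_K1]]
  show "gt * gt * (gt * gt) \<in> K1" by (rule gt_4_K1)
  show "gt * gt \<in> central_mod Grig K1"
  proof (rule central_gensI[OF normal_in_K1])
    show "comm ga (gt * gt) \<in> K1" "comm gb (gt * gt) \<in> K1"
      unfolding comm_gen_gt_sq by (intro K1(3) gt_4_K1)+
    have "inverse gt * (ga * gc * inverse gt * inverse (ga * gc)) \<in> Kgrp"
      by (intro K_D(2,6)) simp_all
    then show "comm gd (gt * gt) \<in> K1"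
      unfolding comm_gen_gt_sq(3) pairs_pair by (auto)
  qed simp
qed

lemmas M_D [simp] = is_subgroup_D[OF normal_in_D(1)[OF normal_in_M]]
  subsetD[OF normal_in_D(2)[OF normal_in_M]] normal_in_D(3)[OF normal_in_M]

lemma K1_M: "x \<in> K1 \<Longrightarrow> x \<in> Mgrp" and gt_sq_M: "gt * gt \<in> Mgrp"
proof -
  have "gt * gt * 1 \<in> Mgrp"
    unfolding Mgrp_def adjoin_def using is_subgroup_D(1)[OF normal_in_D(1)[OF normal_in_K1]] by blast
  then show "gt * gt \<in> Mgrp" by simp
qed (simp add: Mgrp_def adjoin_def)

lemma gt_central_M: "gt \<in> central_mod Grig Mgrp"
proof (rule central_gensI[OF normal_in_M])
  have "comm ga gt = inverse (gt * gt)" "comm gb gt = inverse (gt * gt)"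
    by (simp_all add: comm_def gt_def mult.assoc)
  then show "comm ga gt \<in> Mgrp" "comm gb gt \<in> Mgrp" using gt_sq_M M_D(3) by metis+
  have "comm gd gt = pair 1 (inverse gt)" using dtd by (simp add: comm_def mult.assoc)
  then show "comm gd gt \<in> Mgrp" by (simp add: K1_M)
qed simp

text \<open>The right side is a normal subgroup that contains \<open>t\<close>.\<close>

lemma K_eq: "Kgrp = adjoin gt Mgrp"
proof
  have normal_in: "normal_in Grig (adjoin gt Mgrp)"
    by (rule normal_in_adjoin[OF is_subgroup_Grig normal_in_M gt_central_M gt_sq_M])
  show "Kgrp \<subseteq> adjoin gt Mgrp"
  proof
    fix x assume "x \<in> Kgrp"
    then show "x \<in> adjoin gt Mgrp"
    proof (induction rule: Kgrp.induct)
      case K_gt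
      have "gt * 1 \<in> adjoin gt Mgrp" unfolding adjoin_def using M_D(1) by blast
      then show ?case by simp
    next
      case (K_conj x s)
      then have "s * x * inverse s \<in> adjoin gt Mgrp" by (intro normal_in_D(3)[OF normal_in]) auto
      then show ?case using K_conj by auto
    qed (auto intro: is_subgroup_D[OF normal_in_D(1)[OF normal_in]])
  qed
  have "x \<in> Kgrp" if "x \<in> K1" for x using that pair_K by (auto simp: pairs_def)
  then show "adjoin gt Mgrp \<subseteq> Kgrp" by (auto simp: adjoin_def Mgrp_def)
qed

lemma M_K: "x \<in> Mgrp \<Longrightarrow> x \<in> Kgrp"
  by (simp add: K_eq adjoin_def)

lemma M_cancel:
  "x \<in> Mgrp \<Longrightarrow> x * y \<in> Mgrp \<longleftrightarrow> y \<in> Mgrp" "y \<in> Mgrp \<Longrightarrow> x * y \<in> Mgrp \<longleftrightarrow> x \<in> Mgrp"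
proof -
  show "x * y \<in> Mgrp \<longleftrightarrow> y \<in> Mgrp" if "x \<in> Mgrp"
    using that M_D(2)[OF M_D(3)[OF that], of "x * y"] by auto
  show "x * y \<in> Mgrp \<longleftrightarrow> x \<in> Mgrp" if "y \<in> Mgrp"
    using that M_D(2)[of "x * y" "inverse y"] by (auto simp: mult.assoc)
qed

text \<open>The group \<open>M\<close> is the kernel of a homomorphism from \<open>K\<close> to a group of order two that is
  invariant under conjugation by \<open>G\<close>. With these rules, claims about classes modulo \<open>M\<close> become
  propositional logic.\<close>

lemma M_parity:
  shows "x \<in> Kgrp \<Longrightarrow> y \<in> Kgrp \<Longrightarrow> x * y \<in> Mgrp \<longleftrightarrow> (x \<in> Mgrp \<longleftrightarrow> y \<in> Mgrp)"
    and "inverse x \<in> Mgrp \<longleftrightarrow> x \<in> Mgrp"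
    and "g \<in> Grig \<Longrightarrow> g * x * inverse g \<in> Mgrp \<longleftrightarrow> x \<in> Mgrp"
proof -
  show "x * y \<in> Mgrp \<longleftrightarrow> (x \<in> Mgrp \<longleftrightarrow> y \<in> Mgrp)" if xy: "x \<in> Kgrp" "y \<in> Kgrp"
  proof (cases "x \<in> Mgrp \<or> y \<in> Mgrp")
    case True
    then show ?thesis using M_cancel[of x y] M_cancel(2)[of y x] by auto
  next
    case False
    then obtain m n where mn: "x = gt * m" "y = gt * n" "m \<in> Mgrp" "n \<in> Mgrp"
      using xy unfolding K_eq adjoin_def by blast
    have "gt * gt * (inverse gt * m * inverse (inverse gt)) * n \<in> Mgrp"
      by (intro M_D(2) M_D(5) Grig_D(3) gt_Grig gt_sq_M mn)
    moreover have "gt * gt * (inverse gt * m * inverse (inverse gt)) * n = x * y"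
      by (simp add: mn mult.assoc)
    ultimately show ?thesis using False by auto
  qed
  show "inverse x \<in> Mgrp \<longleftrightarrow> x \<in> Mgrp"
    using M_D(3)[of x] M_D(3)[of "inverse x"] by auto
  show "g * x * inverse g \<in> Mgrp \<longleftrightarrow> x \<in> Mgrp" if g: "g \<in> Grig"
    using M_D(5)[OF g, of x] M_D(5)[of "inverse g" "g * x * inverse g"] g by (auto simp: mult.assoc)
qed

lemma comm_K_M: "g \<in> Grig \<Longrightarrow> x \<in> Kgrp \<Longrightarrow> comm g x \<in> Mgrp"
  unfolding comm_def by (subst M_parity(1)) (simp_all add: M_parity)

lemma pair_L [simp]: "pair x y \<in> Lgrp \<longleftrightarrow> x \<in> Kgrp \<and> y \<in> Kgrp \<and> (x \<in> Mgrp \<longleftrightarrow> y \<in> Mgrp)"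
  by (auto simp: Lgrp_def)

lemma L_E:
  assumes "z \<in> Lgrp"
  obtains x y where "z = pair x y" "x \<in> Kgrp" "y \<in> Kgrp" "x \<in> Mgrp \<longleftrightarrow> y \<in> Mgrp"
  using assms by (auto simp: Lgrp_def)

lemma L_K1: "x \<in> Lgrp \<Longrightarrow> x \<in> K1" and M1_L: "x \<in> M1 \<Longrightarrow> x \<in> Lgrp"
  by (auto elim!: L_E pairsE simp: M_K)

lemma normal_in_L: "normal_in Grig Lgrp"
proof (rule normal_in_gensI)
  have "pair 1 1 \<in> Lgrp" by simp
  then show "is_subgroup Lgrp" unfolding is_subgroup_def by (auto elim!: L_E simp: M_parity pair_one)
  show "Lgrp \<subseteq> Grig" using L_K1 K1_M by auto
  have conj: "s * x * s \<in> Kgrp" "s * x * s \<in> Mgrp \<longleftrightarrow> x \<in> Mgrp"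
    if "s \<in> {ga, gb, gc, gd}" "x \<in> Kgrp" for s x
  proof -
    have "s \<in> Grig" "inverse s = s" using that(1) by auto
    then show "s * x * s \<in> Kgrp" "s * x * s \<in> Mgrp \<longleftrightarrow> x \<in> Mgrp"
      using that(2) K_D(6)[of s x] M_parity(3)[of s x] by metis+
  qed
  fix x assume "x \<in> Lgrp"
  then obtain u v where x: "x = pair u v" "u \<in> Kgrp" "v \<in> Kgrp" "u \<in> Mgrp \<longleftrightarrow> v \<in> Mgrp" by (rule L_E)
  show "ga * x * ga \<in> Lgrp" "gb * x * gb \<in> Lgrp" "gd * x * gd \<in> Lgrp"
    using x by (simp_all add: conj_pair conj)
qed

lemmas L_D [simp] = is_subgroup_D[OF normal_in_D(1)[OF normal_in_L]]

lemma normal_in_M1: "normal_in Grig M1"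
  using normal_in_pairs[OF normal_in_M] M_K by blast

lemma comm_bd_pair:
  assumes "x \<in> Kgrp" "y \<in> Kgrp"
  shows "comm gb (pair x y) \<in> M1" "comm gd (pair x y) \<in> M1"
proof -
  have "comm gb (pair x y) = pair (comm ga x) (comm gc y)" "comm gd (pair x y) = pair (comm 1 x) (comm gb y)"
    by (simp_all flip: comm_pair gb_pair gd_pair)
  then show "comm gb (pair x y) \<in> M1" "comm gd (pair x y) \<in> M1"
    using assms by (simp_all add: comm_K_M)
qed

lemma comm_a_pair: "comm ga (pair x y) = pair (y * inverse x) (x * inverse y)"
proof -
  have "comm ga (pair x y) = (ga * pair x y * ga) * inverse (pair x y)"
    by (simp only: comm_def gen_inverse)
  then show ?thesis by (simp add: conj_pair)
qed

text \<open>The generators \<open>b\<close> and \<open>d\<close> act on the two entries separately and trivially modulo \<open>M\<close>. The swap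
  \<open>a\<close> is harmless because both entries have the same class.\<close>

lemma L_central: "Lgrp \<subseteq> central_mod Grig M1"
proof
  fix z assume "z \<in> Lgrp"
  then obtain x y where z: "z = pair x y" "x \<in> Kgrp" "y \<in> Kgrp" "x \<in> Mgrp \<longleftrightarrow> y \<in> Mgrp" by (rule L_E)
  show "z \<in> central_mod Grig M1"
    using z by (intro central_gensI[OF normal_in_M1]) (simp_all add: comm_bd_pair comm_a_pair M_parity pair_K)
qed

lemma gt_4_L: "gt * gt * (gt * gt) \<in> Lgrp"
  using gca_4 K_D(3)[OF gca_4] unfolding gt_4_pair pair_L by (simp only: M_parity(2))

text \<open>On \<open>K \<times> K\<close> the swap \<open>a\<close> gives the commutator \<open>(y x\<^sup>-\<^sup>1, x y\<^sup>-\<^sup>1)\<close>, whose entries have equal classes.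
  On \<open>t\<^sup>2\<close> the commutators are known explicitly.\<close>

lemma M_central: "Mgrp \<subseteq> central_mod Grig Lgrp"
proof -
  note C = normal_in_central_mod[OF is_subgroup_Grig normal_in_L]
  have K1: "K1 \<subseteq> central_mod Grig Lgrp"
  proof
    fix z assume "z \<in> K1"
    then obtain x y where z: "z = pair x y" "x \<in> Kgrp" "y \<in> Kgrp" by (rule pairsE)
    have "comm gb z \<in> Lgrp" "comm gd z \<in> Lgrp" using z M1_L comm_bd_pair by blast+
    then show "z \<in> central_mod Grig Lgrp"
      using z by (intro central_gensI[OF normal_in_L]) (auto simp: comm_a_pair M_parity pair_K)
  qed
  have "comm ga (gt * gt) \<in> Lgrp" "comm gb (gt * gt) \<in> Lgrp"
    unfolding comm_gen_gt_sq using gt_4_L by (blast intro: L_D)+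
  moreover have "comm gd (gt * gt) \<in> Lgrp"
  proof -
    let ?g = "ga * gc * inverse gt * inverse (ga * gc)"
    have "?g \<in> Kgrp" "?g \<in> Mgrp \<longleftrightarrow> gt \<in> Mgrp"
      by (intro K_D(6), simp_all del: inv_mult) (subst M_parity(3), simp_all add: M_parity(2))
    then show ?thesis
      unfolding comm_gen_gt_sq pair_L by (simp del: inv_mult add: M_parity(1,2))
  qed
  ultimately have "gt * gt \<in> central_mod Grig Lgrp"
    by (intro central_gensI[OF normal_in_L]) simp_all
  then show ?thesis
    using K1 is_subgroup_D[OF normal_in_D(1)[OF C]] by (auto simp: Mgrp_def adjoin_def)
qed

text \<open>Modulo \<open>L\<close> the group \<open>M\<close> is abelian, generated by the involution \<open>t\<^sup>2\<close> and by \<open>K \<times> K\<close>, whose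
  squares lie in \<open>M \<times> M\<close>.\<close>

lemma M_sq: "m \<in> Mgrp \<Longrightarrow> m * m \<in> Lgrp"
proof -
  have K1: "x * x \<in> Lgrp" if "x \<in> K1" for x
    using that by (auto elim!: pairsE simp: M_parity)
  assume "m \<in> Mgrp"
  then consider "m \<in> K1" | k where "m = gt * gt * k" "k \<in> K1" by (auto simp: Mgrp_def adjoin_def)
  then show ?thesis
  proof cases
    case 2
    have "comm (inverse (gt * gt)) k \<in> Lgrp"
      using M_central K1_M[OF 2(2)] by (auto simp: central_mod_def)
    then have "gt * gt * (gt * gt) * comm (inverse (gt * gt)) k * (k * k) \<in> Lgrp"
      using gt_4_L K1[OF 2(2)] by (blast intro: L_D)
    moreover have "gt * gt * (gt * gt) * comm (inverse (gt * gt)) k * (k * k) = m * m"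
      by (simp add: 2 comm_def mult.assoc)
    ultimately show ?thesis by simp
  qed (rule K1)
qed

section \<open>Finite index\<close>

text \<open>Modulo \<open>K\<close> the involution \<open>(da)\<^sup>2\<close> is central; modulo it and \<open>K\<close>, the generators \<open>a\<close>, \<open>d\<close> and \<open>b\<close> commute. So adjoining
  these four elements one after the other reaches the whole group, doubling the order at most each time.\<close>

lemma finite_index_K: "finite_index Grig Kgrp"
proof -
  define u where "u = (gd * ga) * (gd * ga)"
  have uu: "u * u = 1" using gda_4 by (simp add: u_def mult.assoc)
  have u_pair: "u = pair gb gb" unfolding u_def by (rule da_sq_pair)
  have [simp]: "u \<in> Grig" by (simp add: u_def)
  define R1 where "R1 = adjoin u Kgrp"
  define R2 where "R2 = adjoin ga R1"
  define R3 where "R3 = adjoin gd R2"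
  define R4 where "R4 = adjoin gb R3"
  have adjoin: "1 \<in> N \<Longrightarrow> x \<in> adjoin x N" "y \<in> N \<Longrightarrow> y \<in> adjoin x N" for N :: "tree_auto set" and x y
    unfolding adjoin_def by (auto intro: image_eqI[of _ _ 1])
  have "u \<in> central_mod Grig Kgrp"
  proof (rule central_gensI[OF normal_in_K])
    have "comm ga u = inverse (u * u)" "comm gd u = inverse (u * u)"
      by (simp_all add: comm_def u_def mult.assoc)
    then show "comm ga u \<in> Kgrp" "comm gd u \<in> Kgrp" by (simp_all only: uu inv_one K_D(1))
    have "comm gb u = pair (comm ga gb) (comm gc gb)"
      unfolding u_pair by (simp flip: comm_pair gb_pair)
    moreover have "comm ga gb = gt" "comm gc gb = 1" by (simp_all add: comm_def gt_def mult.assoc)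
    ultimately show "comm gb u \<in> Kgrp" by (simp add: pair_K)
  qed simp
  then have R1: "normal_in Grig R1"
    unfolding R1_def using uu by (intro normal_in_adjoin is_subgroup_Grig normal_in_K) simp_all
  have [simp]: "1 \<in> R1" using is_subgroup_D(1)[OF normal_in_D(1)[OF R1]] .
  have KR1: "x \<in> Kgrp \<Longrightarrow> x \<in> R1" for x by (simp add: R1_def adjoin)
  have uR1: "u \<in> R1" by (simp add: R1_def adjoin)
  have "ga \<in> central_mod Grig R1"
  proof (rule central_gensI[OF R1])
    have "comm gb ga = inverse gt" "comm gd ga = u" "comm ga ga = 1"
      by (simp_all add: comm_def u_def gt_def mult.assoc)
    then show "comm ga ga \<in> R1" "comm gb ga \<in> R1" "comm gd ga \<in> R1"
      using KR1 uR1 by simp_all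
  qed simp
  then have R2: "normal_in Grig R2"
    unfolding R2_def by (intro normal_in_adjoin is_subgroup_Grig R1) simp_all
  have [simp]: "1 \<in> R2" using is_subgroup_D(1)[OF normal_in_D(1)[OF R2]] .
  have "gd \<in> central_mod Grig R2"
  proof (rule central_gensI[OF R2])
    have "comm gb gd = 1" "comm gd gd = 1" by (simp_all add: comm_def mult.assoc)
    then show "comm gb gd \<in> R2" "comm gd gd \<in> R2" by simp_all
    have "comm ga gd = inverse u" by (simp add: comm_def u_def mult.assoc)
    then show "comm ga gd \<in> R2"
      using is_subgroup_D(3)[OF normal_in_D(1)[OF R1] uR1] by (simp add: R2_def adjoin)
  qed simp
  then have R3: "normal_in Grig R3"
    unfolding R3_def by (intro normal_in_adjoin is_subgroup_Grig R2) simp_all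
  have [simp]: "1 \<in> R3" using is_subgroup_D(1)[OF normal_in_D(1)[OF R3]] .
  have "gb \<in> central_mod Grig R3"
  proof (rule central_gensI[OF R3])
    have "comm gb gb = 1" "comm gd gb = 1" "comm ga gb = gt" by (simp_all add: comm_def gt_def mult.assoc)
    then show "comm ga gb \<in> R3" "comm gb gb \<in> R3" "comm gd gb \<in> R3"
      by (simp_all add: R3_def R2_def KR1 adjoin)
  qed simp
  then have R4: "normal_in Grig R4"
    unfolding R4_def by (intro normal_in_adjoin is_subgroup_Grig R3) simp_all
  note R4_D = is_subgroup_D[OF normal_in_D(1)[OF R4]]
  have gens: "ga \<in> R4" "gb \<in> R4" "gd \<in> R4" by (simp_all add: R4_def R3_def R2_def adjoin)
  have "x \<in> R4" if "x \<in> Grig" for x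
    using that by (induction rule: Grig.induct) (use gens R4_D in auto)
  then have "finite_index Grig R4"
    unfolding finite_index_def by (intro exI[of _ "{1}"]) auto
  then show ?thesis
    unfolding R4_def R3_def R2_def R1_def
    using finite_index_adjoin[OF is_subgroup_Grig \<open>u \<in> Grig\<close>] finite_index_adjoin[OF is_subgroup_Grig Grig_gens(1)]
      finite_index_adjoin[OF is_subgroup_Grig Grig_gens(2)] finite_index_adjoin[OF is_subgroup_Grig Grig_gens(4)] by blast
qed

lemma finite_index_mono:
  assumes "finite_index G N" "N \<subseteq> N'"
  shows "finite_index G N'"
  using assms unfolding finite_index_def by (meson subsetD)

text \<open>Each of the inclusions \<open>M \<times> M \<le> L \<le> K \<times> K \<le> M \<le> K\<close> is the adjunction of one element:
  \<open>(t, t)\<close>, \<open>(t, 1)\<close>, \<open>t\<^sup>2\<close> and \<open>t\<close>.\<close>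

lemma finite_index_M1: "finite_index Grig M1"
proof -
  have "finite_index Grig Mgrp"
    using finite_index_K finite_index_adjoin[OF is_subgroup_Grig gt_Grig] by (simp add: K_eq)
  then have K1: "finite_index Grig K1"
    using finite_index_adjoin[OF is_subgroup_Grig, of "gt * gt"] by (simp add: Mgrp_def)
  have memI: "y \<in> adjoin x N" if "inverse x * y \<in> N" for x y :: tree_auto and N
    using that unfolding adjoin_def by (auto intro: image_eqI[of _ _ "inverse x * y"])
  have "K1 \<subseteq> adjoin (pair gt 1) Lgrp"
  proof
    fix z assume "z \<in> K1"
    then obtain x y where z: "z = pair x y" "x \<in> Kgrp" "y \<in> Kgrp" by (rule pairsE)
    show "z \<in> adjoin (pair gt 1) Lgrp"
    proof (cases "x \<in> Mgrp \<longleftrightarrow> y \<in> Mgrp")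
      case True
      then show ?thesis using z by (simp add: adjoin_def)
    next
      case False
      then have "gt \<notin> Mgrp" using z unfolding K_eq adjoin_def by (auto simp: M_D(2))
      then show ?thesis using False z by (intro memI) (simp add: M_parity)
    qed
  qed
  then have "finite_index Grig (adjoin (pair gt 1) Lgrp)" using K1 finite_index_mono by blast
  then have L: "finite_index Grig Lgrp"
    by (rule finite_index_adjoin[OF is_subgroup_Grig, rotated]) (simp add: K_D(4)[OF pair_K])
  have "Lgrp \<subseteq> adjoin (pair gt gt) M1"
  proof
    fix z assume "z \<in> Lgrp"
    then obtain x y where z: "z = pair x y" "x \<in> Kgrp" "y \<in> Kgrp" "x \<in> Mgrp \<longleftrightarrow> y \<in> Mgrp" by (rule L_E)
    show "z \<in> adjoin (pair gt gt) M1"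
    proof (cases "x \<in> Mgrp")
      case True
      then show ?thesis using z by (simp add: adjoin_def)
    next
      case False
      then have "gt \<notin> Mgrp" using z unfolding K_eq adjoin_def by (auto simp: M_D(2))
      then show ?thesis using False z by (intro memI) (simp add: M_parity)
    qed
  qed
  then have "finite_index Grig (adjoin (pair gt gt) M1)" using L finite_index_mono by blast
  then show ?thesis
    by (rule finite_index_adjoin[OF is_subgroup_Grig, rotated]) (simp add: K_D(4)[OF pair_K])
qed

section \<open>Correcting approximations by squares and commutators\<close>

context mult_group
begin

text \<open>The group \<open>J\<close> supplies the elements from which commutators and squares are formed. All
  conditions are internal to \<open>J\<close>, so that they pass coordinatewise to \<open>J \<times> J\<close>, \<open>P \<times> P\<close>, \<open>Q \<times> Q\<close>.\<close>

definition central_step :: "'a set \<Rightarrow> 'a set \<Rightarrow> 'a set \<Rightarrow> bool" where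
  "central_step J P Q \<longleftrightarrow> is_subgroup J \<and> is_subgroup P \<and> is_subgroup Q \<and>
     Q \<subseteq> P \<and> P \<subseteq> J \<and> (\<forall>x\<in>J. \<forall>p\<in>P. comm x p \<in> Q)"

definition comm_step :: "'a set \<Rightarrow> 'a set \<Rightarrow> 'a set \<Rightarrow> bool" where
  "comm_step J P Q \<longleftrightarrow> central_step J P Q \<and> (\<forall>h\<in>P. \<exists>z\<in>J. \<exists>y\<in>J. \<exists>q\<in>Q. comm z y = h * q)"

definition sq_comm_step :: "'a set \<Rightarrow> 'a set \<Rightarrow> 'a set \<Rightarrow> bool" where
  "sq_comm_step J P Q \<longleftrightarrow> central_step J P Q \<and> (\<forall>p\<in>P. p * p \<in> Q) \<and>
     (\<forall>h\<in>P. \<exists>x\<in>J. \<exists>z\<in>J. \<exists>y\<in>J. \<exists>q\<in>Q. x * x * comm z y = h * q)"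

lemma central_stepD:
  assumes "central_step J P Q"
  shows "is_subgroup J" "is_subgroup P" "is_subgroup Q" "q \<in> Q \<Longrightarrow> q \<in> P" "p \<in> P \<Longrightarrow> p \<in> J"
    "x \<in> J \<Longrightarrow> p \<in> P \<Longrightarrow> comm x p \<in> Q" "x \<in> J \<Longrightarrow> q \<in> Q \<Longrightarrow> x * q * inverse x \<in> Q"
proof -
  show *: "is_subgroup J" "is_subgroup P" "is_subgroup Q" "q \<in> Q \<Longrightarrow> q \<in> P" "p \<in> P \<Longrightarrow> p \<in> J"
    "x \<in> J \<Longrightarrow> p \<in> P \<Longrightarrow> comm x p \<in> Q" for q p x
    using assms by (auto simp: central_step_def)
  have "x * q * inverse x = comm x q * q" by (simp add: comm_def mult.assoc)
  then show "x \<in> J \<Longrightarrow> q \<in> Q \<Longrightarrow> x * q * inverse x \<in> Q"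
    using *(4,6) is_subgroup_D(2)[OF *(3)] by simp
qed

text \<open>A commutator in \<open>J\<close> depends modulo \<open>Q\<close> only on the cosets of its entries modulo \<open>P\<close>, because
  \<open>P\<close> is central modulo \<open>Q\<close>.\<close>

lemma comm_perturb:
  assumes C: "central_step J P Q" and "z \<in> J" "y \<in> J" "p \<in> P" "p' \<in> P"
  shows "\<exists>q\<in>Q. comm (z * p) (y * p') = comm z y * q"
proof -
  note D = central_stepD[OF C]
  note J = is_subgroup_D[OF D(1)] and Q = is_subgroup_D[OF D(3)]
  let ?w = "y * p'"
  have w: "?w \<in> J" using assms D by (blast intro: J)
  have "comm p ?w = inverse (comm ?w p)" by (simp add: comm_def mult.assoc)
  then have "comm p ?w \<in> Q" using w assms D(6) Q(3) by simp
  then have 1: "z * comm p ?w * inverse z \<in> Q" using assms D(7) by blast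
  let ?c = "comm z ?w"
  have "?c \<in> J" using assms w unfolding comm_def by (blast intro: J)
  then have 2: "inverse ?c * (z * comm p ?w * inverse z) * ?c \<in> Q"
    using D(7)[OF J(3) 1, of ?c] by simp
  have 3: "y * comm z p' * inverse y \<in> Q" using assms D(6,7) by blast
  have "comm (z * p) ?w = ?c * (inverse ?c * (z * comm p ?w * inverse z) * ?c)"
    by (simp add: comm_mult_left mult.assoc)
  also have "\<dots> = comm z y * (y * comm z p' * inverse y * (inverse ?c * (z * comm p ?w * inverse z) * ?c))"
    by (subst comm_mult_right) (simp only: mult.assoc)
  finally show ?thesis using Q(2)[OF 3 2] by blast
qed

lemma sq_perturb:
  assumes C: "central_step J P Q" and "x \<in> J" "p \<in> P" "p * p \<in> Q"
  shows "\<exists>q\<in>Q. (x * p) * (x * p) = x * x * q"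
proof -
  note D = central_stepD[OF C]
  have "comm (inverse x) p * (p * p) \<in> Q"
    using assms D(6) is_subgroup_D(3)[OF D(1)] is_subgroup_D(2)[OF D(3)] by blast
  moreover have "(x * p) * (x * p) = x * x * (comm (inverse x) p * (p * p))"
    by (simp add: comm_def mult.assoc)
  ultimately show ?thesis by blast
qed

definition covers :: "'a set \<Rightarrow> 'a set \<Rightarrow> 'a set \<Rightarrow> bool" where
  "covers G B P \<longleftrightarrow> (\<forall>g\<in>G. \<exists>p\<in>P. g * p \<in> B)"

end

text \<open>The preimages in \<open>G\<close> of the word balls of a quotient of \<open>G\<close>, for some generating set of the
  quotient, have these properties. Working with them in \<open>G\<close> avoids computing in the quotient.\<close>

locale ball_filtration =
  fixes G :: "'a::mult_group set" and B :: "nat \<Rightarrow> 'a set"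
  assumes G: "is_subgroup G"
    and B_mono: "m \<le> n \<Longrightarrow> B m \<subseteq> B n"
    and B_mult: "x \<in> B m \<Longrightarrow> y \<in> B n \<Longrightarrow> x * y \<in> B (m + n)"
    and B_inv: "x \<in> B n \<Longrightarrow> inverse x \<in> B n"
    and B_exhausts: "g \<in> G \<Longrightarrow> \<exists>n. g \<in> B n"
    and B_split: "x \<in> B (Suc n) \<Longrightarrow> \<exists>s\<in>B 1. \<exists>y\<in>B n. x = s * y"
    and B_sub: "B n \<subseteq> G"
begin

lemma B_comm:
  assumes "z \<in> B l" "y \<in> B l"
  shows "comm z y \<in> B (4 * l)"
proof -
  have "z * y * inverse z * inverse y \<in> B (l + l + l + l)"
    using assms by (intro B_mult B_inv)
  moreover have "l + l + l + l = 4 * l" by simp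
  ultimately show ?thesis by (simp only: comm_def)
qed

text \<open>If \<open>g p\<close> is in the ball, then \<open>p\<^sup>-\<^sup>1\<close> is modulo \<open>Q\<close> a commutator of two elements of the ball.
  Multiplying by it removes \<open>p\<close> modulo \<open>Q\<close>.\<close>

lemma covers_comm_step:
  assumes cov: "covers G (B l) P" and S: "comm_step J P Q" and J: "J \<subseteq> G"
  shows "covers G (B (5 * l)) Q"
  unfolding covers_def
proof
  fix g assume "g \<in> G"
  have C: "central_step J P Q" using S by (simp add: comm_step_def)
  note D = central_stepD[OF C]
  obtain p where p: "p \<in> P" "g * p \<in> B l" using cov \<open>g \<in> G\<close> by (auto simp: covers_def)
  then have "inverse p \<in> P" using is_subgroup_D(3)[OF D(2)] by blast
  then obtain z y q where zy: "z \<in> J" "y \<in> J" "q \<in> Q" "comm z y = inverse p * q"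
    using S unfolding comm_step_def by blast
  obtain p1 p2 where pp: "p1 \<in> P" "p2 \<in> P" "z * p1 \<in> B l" "y * p2 \<in> B l"
    using cov J zy unfolding covers_def by (meson subsetD)
  obtain q' where q': "q' \<in> Q" "comm (z * p1) (y * p2) = comm z y * q'"
    using comm_perturb[OF C zy(1,2) pp(1,2)] by blast
  have "(g * p) * comm (z * p1) (y * p2) \<in> B (l + 4 * l)"
    by (intro B_mult B_comm p pp)
  then have "g * (q * q') \<in> B (5 * l)" by (simp add: q' zy mult.assoc)
  then show "\<exists>q\<in>Q. g * q \<in> B (5 * l)" using zy q' is_subgroup_D(2)[OF D(3)] by blast
qed

lemma covers_sq_comm_step:
  assumes cov: "covers G (B l) P" and S: "sq_comm_step J P Q" and J: "J \<subseteq> G"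
  shows "covers G (B (7 * l)) Q"
  unfolding covers_def
proof
  fix g assume "g \<in> G"
  have C: "central_step J P Q" using S by (simp add: sq_comm_step_def)
  note D = central_stepD[OF C] and Q = is_subgroup_D[OF central_stepD(3)[OF C]]
  obtain p where p: "p \<in> P" "g * p \<in> B l" using cov \<open>g \<in> G\<close> by (auto simp: covers_def)
  then have "inverse p \<in> P" using is_subgroup_D(3)[OF D(2)] by blast
  then obtain x z y q where zy: "x \<in> J" "z \<in> J" "y \<in> J" "q \<in> Q" "x * x * comm z y = inverse p * q"
    using S unfolding sq_comm_step_def by blast
  obtain p0 p1 p2 where pp: "p0 \<in> P" "p1 \<in> P" "p2 \<in> P" "x * p0 \<in> B l" "z * p1 \<in> B l" "y * p2 \<in> B l"
    using cov J zy unfolding covers_def by (meson subsetD)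
  obtain q' where q': "q' \<in> Q" "comm (z * p1) (y * p2) = comm z y * q'"
    using comm_perturb[OF C zy(2,3) pp(2,3)] by blast
  obtain r where r: "r \<in> Q" "(x * p0) * (x * p0) = x * x * r"
    using sq_perturb[OF C zy(1) pp(1)] S pp(1) unfolding sq_comm_step_def by blast
  let ?c = "comm z y"
  have cJ: "?c \<in> J" unfolding comm_def using zy by (intro is_subgroup_D[OF D(1)])
  have r': "inverse ?c * r * ?c \<in> Q" using D(7)[OF is_subgroup_D(3)[OF D(1) cJ] r(1)] by simp
  have "(g * p) * ((x * p0) * (x * p0)) * comm (z * p1) (y * p2) \<in> B (l + (l + l) + 4 * l)"
    by (intro B_mult B_comm p pp)
  moreover have "(g * p) * ((x * p0) * (x * p0)) * comm (z * p1) (y * p2)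
      = g * p * (x * x * ?c) * (inverse ?c * r * ?c * q')"
    unfolding r q' by (simp only: mult.assoc mult_inv_cancel)
  moreover have "\<dots> = g * (q * (inverse ?c * r * ?c * q'))"
    unfolding zy(5) by (simp only: mult.assoc mult_inv_cancel)
  moreover have "l + (l + l) + 4 * l = 7 * l" by simp
  ultimately have "g * (q * (inverse ?c * r * ?c * q')) \<in> B (7 * l)"
    by (simp only:)
  then show "\<exists>q\<in>Q. g * q \<in> B (7 * l)" using zy(4) q'(1) r' Q(2) by blast
qed

text \<open>Let the length of a coset be the radius of the first ball that it meets. Removing the first
  letter of a shortest word gives a coset whose length is smaller by exactly one. So the lengths
  form an initial segment of the natural numbers, with at most \<open>card F\<close> elements.\<close>

lemma covers_card:
  assumes N: "is_subgroup N" and F: "finite F" "F \<subseteq> G" "\<And>g. g \<in> G \<Longrightarrow> \<exists>f\<in>F. \<exists>n\<in>N. g = f * n"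
  shows "covers G (B (card F)) N"
proof -
  define len where "len g = (LEAST l. \<exists>n\<in>N. g * n \<in> B l)" for g
  note ND = is_subgroup_D[OF N]
  have ex: "\<exists>l. \<exists>n\<in>N. g * n \<in> B l" if "g \<in> G" for g
    using B_exhausts[OF that] ND(1) by (metis mult_1_right)
  have len: "\<exists>n\<in>N. g * n \<in> B (len g)" if "g \<in> G" for g
    unfolding len_def using LeastI_ex[OF ex[OF that]] .
  have len_le: "len g \<le> l" if "n \<in> N" "g * n \<in> B l" for g n l
    unfolding len_def using that by (blast intro: Least_le)
  have len_mult: "len (g * n) \<le> len g" if "g \<in> G" "n \<in> N" for g n
  proof -
    obtain m where "m \<in> N" "g * m \<in> B (len g)" using len[OF \<open>g \<in> G\<close>] by blast
    then show ?thesis using that by (intro len_le[of "inverse n * m"]) (auto intro: ND simp: mult.assoc)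
  qed
  have down: "l \<in> len ` G" if l: "Suc l \<in> len ` G" for l
  proof -
    obtain g where g: "g \<in> G" "len g = Suc l" using l by auto
    then obtain n where n: "n \<in> N" "g * n \<in> B (Suc l)" using len by metis
    then obtain s y where sy: "s \<in> B 1" "y \<in> B l" "g * n = s * y" using B_split by blast
    have y: "y \<in> G" using sy(2) B_sub by blast
    have "len y \<le> l" using sy(2) ND(1) by (intro len_le[of 1]) auto
    moreover have "l \<le> len y"
    proof -
      obtain m where m: "m \<in> N" "y * m \<in> B (len y)" using len[OF y] by blast
      have "s * (y * m) \<in> B (1 + len y)" using sy m by (intro B_mult)
      then have "g * (n * m) \<in> B (Suc (len y))" by (simp add: sy(3) flip: mult.assoc)
      then have "len g \<le> Suc (len y)" using n m by (intro len_le[of "n * m"]) (auto intro: ND)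
      then show ?thesis using g by simp
    qed
    ultimately show ?thesis using y by force
  qed
  have sub: "{..k} \<subseteq> len ` G" if "k \<in> len ` G" for k
    using that
  proof (induction k)
    case (Suc k)
    then show ?case using down[of k] by (auto simp: atMost_Suc)
  qed auto
  have image: "len ` G \<subseteq> len ` F"
  proof
    fix k assume "k \<in> len ` G"
    then obtain g where g: "g \<in> G" "k = len g" by blast
    then obtain f n where fn: "f \<in> F" "n \<in> N" "g = f * n" using F(3) by blast
    then have f: "f \<in> G" "g * inverse n = f" using F(2) by (auto simp: mult.assoc)
    have "len f \<le> len g" using len_mult[OF g(1) ND(3)[OF fn(2)]] by (simp only: f(2))
    moreover have "len g \<le> len f" using len_mult[OF f(1) fn(2)] by (simp only: fn(3))
    ultimately show "k \<in> len ` F" using g fn by auto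
  qed
  have "len g \<le> card F" if "g \<in> G" for g
  proof -
    have "{..len g} \<subseteq> len ` F" using sub[of "len g"] image that by blast
    then have "card {..len g} \<le> card (len ` F)" using F(1) by (intro card_mono) auto
    also have "\<dots> \<le> card F" using F(1) by (rule card_image_le)
    finally show ?thesis by simp
  qed
  then show ?thesis unfolding covers_def using len B_mono by blast
qed

end

section \<open>The two correction steps in the Grigorchuk group\<close>

lemma central_step_pairs: "central_step J P Q \<Longrightarrow> central_step (pairs J) (pairs P) (pairs Q)"
  unfolding central_step_def by (auto simp: is_subgroup_pairs elim!: pairsE)

lemma comm_step_pairs:
  assumes "comm_step J P Q" shows "comm_step (pairs J) (pairs P) (pairs Q)"
  unfolding comm_step_def
proof (intro conjI ballI)
  show "central_step (pairs J) (pairs P) (pairs Q)"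
    using assms central_step_pairs by (auto simp: comm_step_def)
  fix h assume "h \<in> pairs P"
  then obtain h0 h1 where h: "h = pair h0 h1" "h0 \<in> P" "h1 \<in> P" by (rule pairsE)
  have *: "\<forall>h\<in>P. \<exists>z\<in>J. \<exists>y\<in>J. \<exists>q\<in>Q. comm z y = h * q" using assms by (simp add: comm_step_def)
  obtain z0 y0 q0 z1 y1 q1 where "z0 \<in> J" "y0 \<in> J" "q0 \<in> Q" "comm z0 y0 = h0 * q0"
    "z1 \<in> J" "y1 \<in> J" "q1 \<in> Q" "comm z1 y1 = h1 * q1"
    using * h(2,3) by blast
  then show "\<exists>z\<in>pairs J. \<exists>y\<in>pairs J. \<exists>q\<in>pairs Q. comm z y = h * q"
    by (intro bexI[of _ "pair z0 z1"] bexI[of _ "pair y0 y1"] bexI[of _ "pair q0 q1"]) (simp_all add: h)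
qed

lemma sq_comm_step_pairs:
  assumes "sq_comm_step J P Q" shows "sq_comm_step (pairs J) (pairs P) (pairs Q)"
  unfolding sq_comm_step_def
proof (intro conjI ballI)
  show "central_step (pairs J) (pairs P) (pairs Q)"
    using assms central_step_pairs by (auto simp: sq_comm_step_def)
  show "p * p \<in> pairs Q" if "p \<in> pairs P" for p
    using that assms by (auto simp: sq_comm_step_def elim!: pairsE)
  fix h assume "h \<in> pairs P"
  then obtain h0 h1 where h: "h = pair h0 h1" "h0 \<in> P" "h1 \<in> P" by (rule pairsE)
  have *: "\<forall>h\<in>P. \<exists>x\<in>J. \<exists>z\<in>J. \<exists>y\<in>J. \<exists>q\<in>Q. x * x * comm z y = h * q"
    using assms by (simp add: sq_comm_step_def)
  obtain x0 z0 y0 q0 where "x0 \<in> J" "z0 \<in> J" "y0 \<in> J" "q0 \<in> Q" "x0 * x0 * comm z0 y0 = h0 * q0"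
    using * h(2) by blast
  moreover obtain x1 z1 y1 q1 where "x1 \<in> J" "z1 \<in> J" "y1 \<in> J" "q1 \<in> Q" "x1 * x1 * comm z1 y1 = h1 * q1"
    using * h(3) by blast
  ultimately show "\<exists>x\<in>pairs J. \<exists>z\<in>pairs J. \<exists>y\<in>pairs J. \<exists>q\<in>pairs Q. x * x * comm z y = h * q"
    by (intro bexI[of _ "pair x0 x1"] bexI[of _ "pair z0 z1"] bexI[of _ "pair y0 y1"]
        bexI[of _ "pair q0 q1"]) (simp_all add: h)
qed

text \<open>The group \<open>M/L\<close> is generated by \<open>t\<^sup>2\<close>, which is a square, and by \<open>(t, 1)\<close>, which is congruent
  modulo \<open>L\<close> to both \<open>[ca, t]\<close> and \<open>[ac, t]\<close>.\<close>

lemma M_mod_L: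
  assumes "h \<in> Mgrp"
  obtains x y where "x \<in> Kgrp" "y \<in> Kgrp"
    "\<And>g. g \<in> {gc * ga, ga * gc} \<Longrightarrow> \<exists>l\<in>Lgrp. x * x * comm g y = h * l"
proof -
  have "\<exists>x\<in>Kgrp. \<exists>k\<in>K1. h = x * x * k"
    using assms unfolding Mgrp_def adjoin_def by (auto intro: bexI[of _ 1] bexI[of _ gt])
  then obtain x u v where h: "x \<in> Kgrp" "h = x * x * pair u v" "u \<in> Kgrp" "v \<in> Kgrp"
    by (auto elim!: pairsE)
  define y where "y = (if u \<in> Mgrp \<longleftrightarrow> v \<in> Mgrp then 1 else gt)"
  have "\<exists>l\<in>Lgrp. x * x * comm g y = h * l" if g: "g \<in> {gc * ga, ga * gc}" for g
  proof (rule bexI[of _ "inverse (pair u v) * comm g y"])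
    show "inverse (pair u v) * comm g y \<in> Lgrp"
    proof (cases "u \<in> Mgrp \<longleftrightarrow> v \<in> Mgrp")
      case True
      then show ?thesis using h by (simp add: y_def comm_def M_parity)
    next
      case False
      \<comment> \<open>Otherwise \<open>M = K\<close>, and all elements of \<open>K\<close> have the same class.\<close>
      then have gt: "gt \<notin> Mgrp" using h unfolding K_eq adjoin_def by (auto simp: M_D(2))
      have gtd: "gd * gt * gd \<in> Kgrp" "gd * gt * gd \<notin> Mgrp"
        using K_D(6)[of gd gt] M_parity(3)[of gd gt] gt by simp_all
      show ?thesis using g False h gt gtd
        by (auto simp del: inv_mult simp: y_def comm_ac_gt M_parity)
    qed
  qed (simp add: h mult.assoc pair_one)
  then show ?thesis using that[of x y] h by (auto simp: y_def split: if_splits)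
qed

text \<open>Both \<open>ca\<close> and \<open>ac\<close> swap the two subtrees, so that their commutators with \<open>(w, 1)\<close> are pairs with
  both entries in the class of \<open>w\<close>.\<close>

lemma L_mod_M1:
  assumes "h \<in> Lgrp"
  obtains y where "y \<in> Kgrp" "\<And>g. g \<in> {gc * ga, ga * gc} \<Longrightarrow> \<exists>m\<in>M1. comm g y = h * m"
proof -
  obtain u v where h: "h = pair u v" "u \<in> Kgrp" "v \<in> Kgrp" "u \<in> Mgrp \<longleftrightarrow> v \<in> Mgrp"
    using assms by (rule L_E)
  define y where "y = pair (inverse u) 1"
  have y: "y \<in> Kgrp" using h by (simp add: y_def pair_K)
  have "comm (gc * ga) y = gc * (ga * y * ga) * gc * inverse y"
    "comm (ga * gc) y = ga * (gc * y * gc) * ga * inverse y"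
    by (simp_all add: comm_def mult.assoc)
  then have comm: "comm (gc * ga) y = pair u (gd * inverse u * inverse gd)"
    "comm (ga * gc) y = pair u (ga * inverse u * inverse ga)"
    by (simp_all add: y_def conj_pair)
  have "\<exists>m\<in>M1. comm g y = h * m" if g: "g \<in> {gc * ga, ga * gc}" for g
  proof (rule bexI[of _ "inverse h * comm g y"])
    have "inverse v * (s * inverse u * inverse s) \<in> Mgrp" if "s \<in> Grig" for s
      using that h by (subst M_parity(1)) (simp_all only: K_D M_parity)
    then show "inverse h * comm g y \<in> M1" using g by (auto simp: comm h(1) simp del: gen_inverse)
  qed simp
  then show ?thesis using that y by blast
qed

lemma comm_M_L: "g \<in> Grig \<Longrightarrow> x \<in> Mgrp \<Longrightarrow> comm g x \<in> Lgrp"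
  using M_central by (auto simp: central_mod_def)

lemma comm_L_M1: "g \<in> Grig \<Longrightarrow> x \<in> Lgrp \<Longrightarrow> comm g x \<in> M1"
  using L_central by (auto simp: central_mod_def)

text \<open>Since \<open>t = (ca, ac)\<close>, a commutator of \<open>t\<close> with a pair \<open>(y\<^sub>0, y\<^sub>1)\<close> is
  \<open>([ca, y\<^sub>0], [ac, y\<^sub>1])\<close>: the two coordinates can be prescribed independently with the same \<open>t\<close>.\<close>

lemma sq_comm_step_K: "sq_comm_step Kgrp M1 (pairs Lgrp)"
  unfolding sq_comm_step_def central_step_def
proof (intro conjI ballI)
  show "is_subgroup Kgrp" "is_subgroup M1" "is_subgroup (pairs Lgrp)"
    using normal_in_K normal_in_M1 is_subgroup_pairs normal_in_L by (auto simp: normal_in_def)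
  show "pairs Lgrp \<subseteq> M1" using L_K1 K1_M by (auto elim!: pairsE)
  show "M1 \<subseteq> Kgrp" using M_K pair_K by (auto elim!: pairsE)
  show "comm x p \<in> pairs Lgrp" if "x \<in> Kgrp" "p \<in> M1" for x p
    using that by (auto elim!: pairsE K_sections simp: comm_M_L)
  show "p * p \<in> pairs Lgrp" if "p \<in> M1" for p
    using that M_sq by (auto elim!: pairsE)
  fix h assume "h \<in> M1"
  then obtain h0 h1 where h: "h = pair h0 h1" "h0 \<in> Mgrp" "h1 \<in> Mgrp" by (rule pairsE)
  obtain x0 y0 l0 where 0: "x0 \<in> Kgrp" "y0 \<in> Kgrp" "l0 \<in> Lgrp" "x0 * x0 * comm (gc * ga) y0 = h0 * l0"
    using M_mod_L[OF h(2)] by (metis insertI1)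
  obtain x1 y1 l1 where 1: "x1 \<in> Kgrp" "y1 \<in> Kgrp" "l1 \<in> Lgrp" "x1 * x1 * comm (ga * gc) y1 = h1 * l1"
    using M_mod_L[OF h(3)] by (metis insertI1 insert_commute)
  have "pair x0 x1 * pair x0 x1 * comm gt (pair y0 y1) = h * pair l0 l1"
    by (simp add: gt_pair 0 1 h)
  then show "\<exists>x\<in>Kgrp. \<exists>z\<in>Kgrp. \<exists>y\<in>Kgrp. \<exists>q\<in>pairs Lgrp. x * x * comm z y = h * q"
    using 0 1 by (metis pair_K K_gt pairs_pair)
qed

lemma comm_step_K: "comm_step Kgrp (pairs Lgrp) (pairs M1)"
  unfolding comm_step_def central_step_def
proof (intro conjI ballI)
  show "is_subgroup Kgrp" "is_subgroup (pairs M1)" "is_subgroup (pairs Lgrp)"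
    using normal_in_K normal_in_M1 is_subgroup_pairs normal_in_L by (auto simp: normal_in_def)
  show "pairs M1 \<subseteq> pairs Lgrp" using M1_L by (auto elim!: pairsE simp: M_K)
  show "pairs Lgrp \<subseteq> Kgrp" using L_K1 K1_M M_K pair_K by (auto elim!: pairsE)
  show "comm x p \<in> pairs M1" if "x \<in> Kgrp" "p \<in> pairs Lgrp" for x p
    using that(1)
  proof (rule K_sections)
    fix g h assume "x = pair g h" "g \<in> Grig" "h \<in> Grig"
    then show ?thesis using that(2) by (auto elim!: pairsE[of _ Lgrp] simp: comm_L_M1)
  qed
  fix h assume "h \<in> pairs Lgrp"
  then obtain h0 h1 where h: "h = pair h0 h1" "h0 \<in> Lgrp" "h1 \<in> Lgrp" by (rule pairsE)
  obtain y0 l0 where 0: "y0 \<in> Kgrp" "l0 \<in> M1" "comm (gc * ga) y0 = h0 * l0"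
    using L_mod_M1[OF h(2)] by (metis insertI1)
  obtain y1 l1 where 1: "y1 \<in> Kgrp" "l1 \<in> M1" "comm (ga * gc) y1 = h1 * l1"
    using L_mod_M1[OF h(3)] by (metis insertI1 insert_commute)
  have "comm gt (pair y0 y1) = h * pair l0 l1"
    by (simp add: gt_pair 0 1 h)
  then show "\<exists>z\<in>Kgrp. \<exists>y\<in>Kgrp. \<exists>q\<in>pairs M1. comm z y = h * q"
    using 0 1 by (metis pair_K K_gt pairs_pair)
qed

lemma pairs_power_K: "(pairs ^^ j) Kgrp \<subseteq> Grig"
proof -
  have "(pairs ^^ j) Kgrp \<subseteq> Kgrp"
    by (induction j) (auto elim!: pairsE intro!: pair_K)
  then show ?thesis by (auto simp: K_D(4))
qed

text \<open>In the notation of the introduction these are the steps from \<open>M\<^sub>j\<^sub>+\<^sub>1\<close> to \<open>L\<^sub>j\<^sub>+\<^sub>1\<close> and from \<open>L\<^sub>j\<^sub>+\<^sub>1\<close> to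
  \<open>M\<^sub>j\<^sub>+\<^sub>2\<close>: the groups \<open>M \<times> M\<close> and \<open>L \<times> L\<close> are already one level below the root.\<close>

lemma steps_power:
  "sq_comm_step ((pairs ^^ j) Kgrp) ((pairs ^^ j) M1) ((pairs ^^ j) (pairs Lgrp))"
  "comm_step ((pairs ^^ j) Kgrp) ((pairs ^^ j) (pairs Lgrp)) ((pairs ^^ Suc j) M1)"
proof -
  show "sq_comm_step ((pairs ^^ j) Kgrp) ((pairs ^^ j) M1) ((pairs ^^ j) (pairs Lgrp))"
    by (induction j) (simp_all add: sq_comm_step_K sq_comm_step_pairs)
  have "comm_step ((pairs ^^ j) Kgrp) ((pairs ^^ j) (pairs Lgrp)) ((pairs ^^ j) (pairs M1))"
    by (induction j) (simp_all add: comm_step_K comm_step_pairs)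
  then show "comm_step ((pairs ^^ j) Kgrp) ((pairs ^^ j) (pairs Lgrp)) ((pairs ^^ Suc j) M1)"
    by (simp add: funpow_swap1)
qed

lemma covers_35:
  assumes "ball_filtration Grig B" "covers Grig (B l) M1"
  shows "covers Grig (B (35 ^ j * l)) ((pairs ^^ j) M1)"
proof (induction j)
  case 0
  then show ?case using assms by simp
next
  case (Suc j)
  interpret ball_filtration Grig B by fact
  have "covers Grig (B (5 * (7 * (35 ^ j * l)))) ((pairs ^^ Suc j) M1)"
    using covers_comm_step[OF covers_sq_comm_step[OF Suc steps_power(1) pairs_power_K]
        steps_power(2) pairs_power_K] .
  then show ?case by (simp add: mult.assoc)
qed

section \<open>Word balls and the diameter\<close>

context group
begin

lemma word_ball_mult:
  assumes S: "S \<subseteq> carrier G" and x: "x \<in> word_ball G S m" and y: "y \<in> word_ball G S n"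
  shows "x \<otimes> y \<in> word_ball G S (m + n)"
proof -
  obtain xs ys where xs: "x = foldr (\<otimes>) xs \<one>" "set xs \<subseteq> S \<union> set_inv S" "length xs \<le> m"
    and ys: "y = foldr (\<otimes>) ys \<one>" "set ys \<subseteq> S \<union> set_inv S" "length ys \<le> n"
    using x y unfolding word_ball_def by blast
  have "S \<union> set_inv S \<subseteq> carrier G" using S set_inv_subset by blast
  then have "x \<otimes> y = foldr (\<otimes>) (xs @ ys) \<one>"
    using xs ys by (subst foldr_mult_append) auto
  then show ?thesis
    using xs(2,3) ys(2,3) unfolding word_ball_def by (intro CollectI exI[of _ "xs @ ys"]) auto
qed

lemma word_ball_inv:
  assumes S: "S \<subseteq> carrier G" and x: "x \<in> word_ball G S n"
  shows "inv x \<in> word_ball G S n"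
proof -
  obtain xs where xs: "x = foldr (\<otimes>) xs \<one>" "set xs \<subseteq> S \<union> set_inv S" "length xs \<le> n"
    using x unfolding word_ball_def by blast
  have carr: "S \<union> set_inv S \<subseteq> carrier G" using S set_inv_subset by blast
  have sym: "inv s \<in> S \<union> set_inv S" if "s \<in> S \<union> set_inv S" for s
    using that S by (auto simp: SET_INV_def)
  have "inv (foldr (\<otimes>) ys \<one>) = foldr (\<otimes>) (rev (map (m_inv G) ys)) \<one>" if "set ys \<subseteq> S \<union> set_inv S" for ys
    using that
  proof (induction ys)
    case (Cons s ys)
    then have carr': "s \<in> carrier G" "set ys \<subseteq> carrier G" "set (rev (map (m_inv G) ys)) \<subseteq> carrier G"
      using carr by auto
    then show ?case
      using Cons by (auto simp: inv_mult_group foldr_mult_closed foldr_mult_append simp del: foldr_append)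
  qed simp
  then show ?thesis
    using xs sym unfolding word_ball_def by (intro CollectI exI[of _ "rev (map (m_inv G) xs)"]) auto
qed

lemma word_ball_split:
  assumes S: "S \<subseteq> carrier G" and x: "x \<in> word_ball G S (Suc n)"
  shows "\<exists>s\<in>word_ball G S 1. \<exists>y\<in>word_ball G S n. x = s \<otimes> y"
proof -
  obtain xs where xs: "x = foldr (\<otimes>) xs \<one>" "set xs \<subseteq> S \<union> set_inv S" "length xs \<le> Suc n"
    using x unfolding word_ball_def by blast
  have carr: "S \<union> set_inv S \<subseteq> carrier G" using S set_inv_subset by blast
  have "x = foldr (\<otimes>) (take 1 xs) \<one> \<otimes> foldr (\<otimes>) (drop 1 xs) \<one>"
    using xs carr set_take_subset[of 1 xs] set_drop_subset[of 1 xs]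
    by (subst foldr_mult_append[symmetric]) auto
  moreover have "foldr (\<otimes>) (take 1 xs) \<one> \<in> word_ball G S 1"
    using xs(2) set_take_subset[of 1 xs] unfolding word_ball_def by (intro CollectI exI[of _ "take 1 xs"]) auto
  moreover have "foldr (\<otimes>) (drop 1 xs) \<one> \<in> word_ball G S n"
    using xs(2,3) set_drop_subset[of 1 xs] unfolding word_ball_def by (intro CollectI exI[of _ "drop 1 xs"]) auto
  ultimately show ?thesis by blast
qed

lemma diam_le:
  assumes "finite (carrier G)" "\<And>S. generates G S \<Longrightarrow> word_ball G S l = carrier G"
  shows "diam G \<le> l"
  unfolding diam_def
proof (rule Max.boundedI)
  show "finite {diam_wrt G S |S. generates G S}" "{diam_wrt G S |S. generates G S} \<noteq> {}"
    using diam_set_finite_nonempty[OF assms(1)] .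
  show "d \<le> l" if "d \<in> {diam_wrt G S |S. generates G S}" for d
    using that assms(2) unfolding diam_wrt_def by (auto intro: Least_le)
qed

end

section \<open>Quotients by level stabilisers\<close>

lemma act_Grig: "act ` Grig = carrier grigorchuk"
proof
  interpret A: group tree_aut by (rule group_tree_aut)
  interpret S: subgroup "carrier grigorchuk" tree_aut by (rule subgroup_grigorchuk)
  have gens: "grig_a \<in> carrier grigorchuk" "grig_b \<in> carrier grigorchuk" "grig_d \<in> carrier grigorchuk"
    by (auto simp: grigorchuk_def intro: generate.incl)
  have "act x \<in> carrier grigorchuk" if "x \<in> Grig" for x
    using that
  proof (induction rule: Grig.induct)
    case Grig_one
    then show ?case using S.one_closed unfolding one_tree_aut act_one .
  next
    case (Grig_step s g)
    then have s: "act s \<in> carrier grigorchuk" using gens by (auto simp: act_gens)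
    then have "act s \<otimes>\<^bsub>tree_aut\<^esub> act g \<in> carrier grigorchuk" using Grig_step by (intro S.m_closed)
    then show ?case by (simp add: mult_tree_aut comp_def)
  qed
  then show "act ` Grig \<subseteq> carrier grigorchuk" by blast
  have "f \<in> act ` Grig" if "f \<in> generate tree_aut {grig_a, grig_b, grig_c, grig_d}" for f
    using that
  proof (induction rule: generate.induct)
    case one
    then show ?case by (auto simp: one_tree_aut intro!: image_eqI[of _ _ 1])
  next
    case (incl h)
    then show ?case by (auto simp flip: act_gens)
  next
    case (inv h)
    then obtain s where s: "s \<in> {ga, gb, gc, gd}" "h = act s" by (auto simp flip: act_gens)
    then have "act s \<otimes>\<^bsub>tree_aut\<^esub> act s = \<one>\<^bsub>tree_aut\<^esub>"
      by (auto simp: mult_tree_aut one_tree_aut simp flip: act_mult)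
    then have "inv\<^bsub>tree_aut\<^esub> h = act s" using s(2) A.inv_equality by simp
    then show ?case using s by auto
  next
    case (eng f g)
    then show ?case by (auto simp: mult_tree_aut image_iff simp flip: act_mult)
  qed
  then show "carrier grigorchuk \<subseteq> act ` Grig" by (auto simp: grigorchuk_def)
qed

lemma act_mult_grigorchuk: "act x \<otimes>\<^bsub>grigorchuk\<^esub> act y = act (x * y)"
  using mult_tree_aut[of "act x" "act y"] by (simp add: grigorchuk_def)

lemma act_level_stab_in: "x \<in> Grig \<Longrightarrow>
    act x \<in> level_stab_in grigorchuk n \<longleftrightarrow> (\<forall>w. length w = n \<longrightarrow> act x w = w)"
  using act_Grig by (auto simp: level_stab_in_def level_stab_def)

definition level_coset :: "nat \<Rightarrow> tree_auto \<Rightarrow> (vertex \<Rightarrow> vertex) set" where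
  "level_coset n x = level_stab_in grigorchuk n #>\<^bsub>grigorchuk\<^esub> act x"

abbreviation level_quot :: "nat \<Rightarrow> (vertex \<Rightarrow> vertex) set monoid" where
  "level_quot n \<equiv> grigorchuk Mod level_stab_in grigorchuk n"

lemma level_coset_image: "level_coset n ` Grig = carrier (level_quot n)"
  unfolding carrier_FactGroup act_Grig[symmetric] level_coset_def by (simp add: image_image)

lemma level_coset_mult:
  assumes "x \<in> Grig" "y \<in> Grig"
  shows "level_coset n (x * y) = level_coset n x \<otimes>\<^bsub>level_quot n\<^esub> level_coset n y"
proof -
  interpret N: normal "level_stab_in grigorchuk n" grigorchuk by (rule normal_level_stab_grigorchuk)
  have "act x \<in> carrier grigorchuk" "act y \<in> carrier grigorchuk" using assms act_Grig by auto
  then show ?thesis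
    by (simp add: level_coset_def N.rcos_sum act_mult_grigorchuk FactGroup_def)
qed

lemma level_coset_one:
  assumes "x \<in> Grig" "\<And>w. length w = n \<Longrightarrow> act x w = w"
  shows "level_coset n x = \<one>\<^bsub>level_quot n\<^esub>"
proof -
  interpret G: group grigorchuk by (rule group_grigorchuk)
  interpret N: normal "level_stab_in grigorchuk n" grigorchuk by (rule normal_level_stab_grigorchuk)
  have "act x \<in> level_stab_in grigorchuk n" using act_level_stab_in assms by blast
  then show ?thesis by (simp add: level_coset_def FactGroup_def N.rcos_const[OF G.group_axioms])
qed

lemma level_coset_inverse:
  assumes "x \<in> Grig"
  shows "level_coset n (inverse x) = inv\<^bsub>level_quot n\<^esub> level_coset n x"
proof -
  interpret Q: group "level_quot n" by (rule group_grigorchuk_quotient)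
  have "level_coset n (inverse x) \<otimes>\<^bsub>level_quot n\<^esub> level_coset n x = \<one>\<^bsub>level_quot n\<^esub>"
    using level_coset_mult[of "inverse x" x n] level_coset_one[of 1 n] assms by simp
  then show ?thesis
    using assms level_coset_image[of n] by (intro Q.inv_equality[symmetric]) auto
qed

lemma ball_filtration_word_ball:
  assumes gen: "generates (level_quot n) S"
  shows "ball_filtration Grig (\<lambda>l. {x \<in> Grig. level_coset n x \<in> word_ball (level_quot n) S l})"
proof
  interpret Q: group "level_quot n" by (rule group_grigorchuk_quotient)
  have S: "S \<subseteq> carrier (level_quot n)" and gen': "generate (level_quot n) S = carrier (level_quot n)"
    using gen by (auto simp: generates_def)
  show "is_subgroup Grig" by (rule is_subgroup_Grig)
  fix x y k l
  let ?B = "\<lambda>l. {x \<in> Grig. level_coset n x \<in> word_ball (level_quot n) S l}"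
  show "?B k \<subseteq> ?B l" if "k \<le> l" using word_ball_mono[OF that, of "level_quot n" S] by blast
  show "x * y \<in> ?B (k + l)" if "x \<in> ?B k" "y \<in> ?B l"
    using that by (simp add: level_coset_mult Q.word_ball_mult[OF S] del: mult_FactGroup)
  show "inverse x \<in> ?B l" if "x \<in> ?B l"
    using that by (simp add: level_coset_inverse Q.word_ball_inv[OF S])
  show "\<exists>l. x \<in> ?B l" if "x \<in> Grig"
    using that Q.generate_imp_word_ball[OF S, of "level_coset n x"] level_coset_image[of n] gen' by auto
  show "?B l \<subseteq> Grig" by blast
  show "\<exists>s\<in>?B 1. \<exists>y\<in>?B l. x = s * y" if x: "x \<in> ?B (Suc l)"
  proof -
    obtain s' y' where sy: "s' \<in> word_ball (level_quot n) S 1" "y' \<in> word_ball (level_quot n) S l"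
      "level_coset n x = s' \<otimes>\<^bsub>level_quot n\<^esub> y'"
      using x Q.word_ball_split[OF S] by blast
    then have carr: "s' \<in> carrier (level_quot n)" "y' \<in> carrier (level_quot n)"
      using Q.word_ball_subset[OF S] by blast+
    then obtain s where s: "s \<in> Grig" "s' = level_coset n s" using level_coset_image[of n] by blast
    have "level_coset n (inverse s * x) = y'"
      using s x sy(3) carr by (simp add: level_coset_mult level_coset_inverse del: mult_FactGroup one_FactGroup flip: Q.m_assoc)
    then show ?thesis
      using s x sy by (intro bexI[of _ s] bexI[of _ "inverse s * x"]) auto
  qed
qed

lemma act_pairs_power: "x \<in> (pairs ^^ n) A \<Longrightarrow> length w = n \<Longrightarrow> act x w = w"
proof (induction n arbitrary: x w)
  case (Suc n)
  then obtain u v where "x = pair u v" "u \<in> (pairs ^^ n) A" "v \<in> (pairs ^^ n) A"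
    by (auto elim: pairsE)
  then show ?case using Suc by (cases w rule: grig_a.cases) (auto simp: act_pair)
next
  case 0
  then show ?case using length_tree_aut[of "act x" "[]"] by simp
qed

text \<open>The radius \<open>card F\<close> of the first step depends neither on the level nor on the generating set.
  This makes the constant absolute.\<close>

lemma diam_bound: "\<exists>c. \<forall>n. diam (level_quot n) \<le> 35 ^ n * c"
proof -
  obtain F where F: "finite F" "F \<subseteq> Grig" "\<And>g. g \<in> Grig \<Longrightarrow> \<exists>f\<in>F. \<exists>m\<in>M1. g = f * m"
    using finite_index_M1 unfolding finite_index_def by blast
  have "diam (level_quot n) \<le> 35 ^ n * card F" for n
  proof -
    interpret Q: group "level_quot n" by (rule group_grigorchuk_quotient)
    show ?thesis
    proof (rule Q.diam_le[OF finite_grigorchuk_quotient])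
      fix S assume gen: "generates (level_quot n) S"
      let ?W = "word_ball (level_quot n) S (35 ^ n * card F)"
      interpret ball_filtration Grig "\<lambda>l. {x \<in> Grig. level_coset n x \<in> word_ball (level_quot n) S l}"
        by (rule ball_filtration_word_ball[OF gen])
      have "covers Grig {x \<in> Grig. level_coset n x \<in> ?W} ((pairs ^^ n) M1)"
        using covers_35[OF ball_filtration_axioms covers_card[OF normal_in_D(1)[OF normal_in_M1] F]] .
      then have cov: "\<exists>p\<in>(pairs ^^ n) M1. g * p \<in> Grig \<and> level_coset n (g * p) \<in> ?W" if "g \<in> Grig" for g
        using that unfolding covers_def by blast
      have "level_coset n g \<in> ?W" if g: "g \<in> Grig" for g
      proof -
        obtain p where p: "p \<in> (pairs ^^ n) M1" "g * p \<in> Grig" "level_coset n (g * p) \<in> ?W"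
          using cov[OF g] by blast
        have "inverse g * (g * p) \<in> Grig" by (rule Grig_D(2)[OF Grig_D(3)[OF g] p(2)])
        then have "p \<in> Grig" unfolding inv_mult_cancel .
        then have "level_coset n p = \<one>\<^bsub>level_quot n\<^esub>"
          using p(1) act_pairs_power by (intro level_coset_one) auto
        then have "level_coset n (g * p) = level_coset n g \<otimes>\<^bsub>level_quot n\<^esub> \<one>\<^bsub>level_quot n\<^esub>"
          using g \<open>p \<in> Grig\<close> by (simp only: level_coset_mult)
        also have "\<dots> = level_coset n g"
          using g level_coset_image[of n] by (intro Q.r_one) blast
        finally show ?thesis using p(3) by simp
      qed
      then have "carrier (level_quot n) \<subseteq> ?W" unfolding level_coset_image[symmetric] by blast
      moreover have "?W \<subseteq> carrier (level_quot n)"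
        using gen by (intro Q.word_ball_subset) (simp add: generates_def)
      ultimately show "?W = carrier (level_quot n)" by (rule subset_antisym[rotated])
    qed
  qed
  then show ?thesis by blast
qed

section \<open>The index of the level stabilisers\<close>

lemma card_rcosets_ge:
  assumes D: "D \<subseteq> Grig"
    and sep: "\<And>x y. x \<in> D \<Longrightarrow> y \<in> D \<Longrightarrow> x \<noteq> y \<Longrightarrow> \<exists>w. length w = n \<and> act x w \<noteq> act y w"
  shows "card D \<le> card (rcosets\<^bsub>grigorchuk\<^esub> level_stab_in grigorchuk n)"
proof -
  interpret G: group grigorchuk by (rule group_grigorchuk)
  interpret N: normal "level_stab_in grigorchuk n" grigorchuk by (rule normal_level_stab_grigorchuk)
  have quot: "carrier (level_quot n) = rcosets\<^bsub>grigorchuk\<^esub> level_stab_in grigorchuk n"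
    by (simp add: FactGroup_def)
  have "inj_on (level_coset n) D"
  proof (rule inj_onI, rule ccontr)
    fix x y assume xy: "x \<in> D" "y \<in> D" "level_coset n x = level_coset n y" "x \<noteq> y"
    then obtain w where w: "length w = n" "act x w \<noteq> act y w" using sep by blast
    have "act x \<in> level_coset n x"
      unfolding level_coset_def using D xy act_Grig N.subgroup_axioms by (intro G.rcos_self) auto
    then have "act x \<in> level_coset n y" by (simp only: xy(3))
    then obtain f where f: "f \<in> level_stab_in grigorchuk n" "act x = f \<otimes>\<^bsub>grigorchuk\<^esub> act y"
      unfolding level_coset_def r_coset_def by auto
    then obtain z where z: "z \<in> Grig" "f = act z" using N.subset act_Grig by blast
    then have "act x w = act z (act y w)" using f act_mult_grigorchuk by simp
    also have "\<dots> = act y w"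
      using f(1) z w(1) length_tree_aut[of "act y" w] by (simp add: act_level_stab_in)
    finally show False using w by simp
  qed
  moreover have "level_coset n ` D \<subseteq> rcosets\<^bsub>grigorchuk\<^esub> level_stab_in grigorchuk n"
    using D level_coset_image[of n] quot by blast
  moreover have "finite (rcosets\<^bsub>grigorchuk\<^esub> level_stab_in grigorchuk n)"
    using finite_grigorchuk_quotient[of n] quot by simp
  ultimately show ?thesis by (rule card_inj_on_le)
qed

lemma gt_moves: "act gt [False, False] = [False, True]"
  by (simp add: gt_def act_gens)

text \<open>Two choices of \<open>1\<close> or \<open>t\<close> at the vertices of level \<open>j\<close> differ at some vertex, and \<open>t\<close> moves a
  vertex two levels further down.\<close>

lemma pairs_power_sep:
  "x \<in> (pairs ^^ j) {1, gt} \<Longrightarrow> y \<in> (pairs ^^ j) {1, gt} \<Longrightarrow> x \<noteq> y \<Longrightarrow>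
    \<exists>w. length w = j + 2 \<and> act x w \<noteq> act y w"
proof (induction j arbitrary: x y)
  case 0
  then have "act x [False, False] \<noteq> act y [False, False]" using gt_moves by auto
  then show ?case by (intro exI[of _ "[False, False]"]) simp
next
  case (Suc j)
  from Suc.prems(1) obtain x0 x1 where x: "x = pair x0 x1" "x0 \<in> (pairs ^^ j) {1, gt}" "x1 \<in> (pairs ^^ j) {1, gt}"
    by (auto elim: pairsE)
  from Suc.prems(2) obtain y0 y1 where y: "y = pair y0 y1" "y0 \<in> (pairs ^^ j) {1, gt}" "y1 \<in> (pairs ^^ j) {1, gt}"
    by (auto elim: pairsE)
  show ?case
  proof (cases "x0 = y0")
    case True
    then obtain w where "length w = j + 2" "act x1 w \<noteq> act y1 w" using Suc x y by blast
    then show ?thesis by (intro exI[of _ "True # w"]) (simp add: x y act_pair)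
  next
    case False
    then obtain w where "length w = j + 2" "act x0 w \<noteq> act y0 w" using Suc x y by blast
    then show ?thesis by (intro exI[of _ "False # w"]) (simp add: x y act_pair)
  qed
qed

lemma card_pairs: "card (pairs A) = card A ^ 2"
proof -
  have "pairs A = (\<lambda>(x, y). pair x y) ` (A \<times> A)" by (auto simp: pairs_def)
  moreover have "inj_on (\<lambda>(x, y). pair x y) (A \<times> A)" by (auto intro!: inj_onI)
  ultimately show ?thesis by (simp add: card_image card_cartesian_product power2_eq_square)
qed

lemma card_pairs_power: "card ((pairs ^^ j) {1, gt}) = 2 ^ 2 ^ j"
proof (induction j)
  case 0
  have "gt \<noteq> 1" using gt_moves by auto
  then show ?case by simp
next
  case (Suc j)
  then show ?case by (simp add: card_pairs power_mult[symmetric] mult.commute)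
qed

lemma card_level_quot_ge: "2 ^ 2 ^ j \<le> card (rcosets\<^bsub>grigorchuk\<^esub> level_stab_in grigorchuk (j + 2))"
proof -
  have "(pairs ^^ j) {1, gt} \<subseteq> Kgrp" by (induction j) (auto elim!: pairsE intro!: pair_K)
  then have "(pairs ^^ j) {1, gt} \<subseteq> Grig" using K_D(4) by blast
  then show ?thesis
    using card_rcosets_ge[of "(pairs ^^ j) {1, gt}" "j + 2"] pairs_power_sep card_pairs_power by force
qed

lemma card_level_quot_1: "2 \<le> card (rcosets\<^bsub>grigorchuk\<^esub> level_stab_in grigorchuk 1)"
proof -
  have ne: "act ga [False] \<noteq> act 1 [False]" by (simp add: act_gens)
  then have "ga \<noteq> 1" by metis
  have "\<exists>w. length w = 1 \<and> act x w \<noteq> act y w" if "x \<in> {1, ga}" "y \<in> {1, ga}" "x \<noteq> y" for x y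
    using that ne by (intro exI[of _ "[False]"]) auto
  then have "card {1, ga} \<le> card (rcosets\<^bsub>grigorchuk\<^esub> level_stab_in grigorchuk 1)"
    by (intro card_rcosets_ge) auto
  then show ?thesis using \<open>ga \<noteq> 1\<close> by simp
qed

text \<open>The constant comes from \<open>2\<^sup>j = 2\<^sup>n / 4\<close> for \<open>n = j + 2\<close>. For \<open>n = 1\<close> there is no such \<open>j\<close>, and
  the generator \<open>a\<close> shows that the index is at least two.\<close>

lemma ln_index_ge:
  assumes "n \<ge> 1"
  shows "ln 2 / 4 * 2 ^ n \<le> ln (real (card (rcosets\<^bsub>grigorchuk\<^esub> level_stab_in grigorchuk n)))"
proof -
  define k where "k = card (rcosets\<^bsub>grigorchuk\<^esub> level_stab_in grigorchuk n)"
  consider "n = 1" | j where "n = j + 2" using assms by (metis One_nat_def Suc_1 add.commute le_Suc_ex not_less_eq_eq le_antisym)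
  then have "ln 2 / 4 * 2 ^ n \<le> ln (real k)"
  proof cases
    case 1
    have "ln 2 \<le> ln (real k)" using card_level_quot_1 1 by (simp add: k_def)
    moreover have "ln 2 / 4 * 2 ^ n \<le> ln (2::real)" using 1 by simp
    ultimately show ?thesis by linarith
  next
    case 2
    have "real (2 ^ 2 ^ j) \<le> real k" using card_level_quot_ge[of j] 2 unfolding k_def of_nat_le_iff by simp
    then have "ln (2 ^ 2 ^ j) \<le> ln (real k)" by (simp add: ln_mono)
    moreover have "ln (2 ^ 2 ^ j) = ln 2 / 4 * (2 ^ n :: real)" using 2 by (simp add: ln_realpow power_add)
    ultimately show ?thesis by simp
  qed
  then show ?thesis by (simp add: k_def)
qed

section \<open>The diameter bounds\<close>

theorem theorem1p1:
  shows "(\<exists>C>0. \<forall>n\<ge>1.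
            real (diam (grigorchuk Mod level_stab_in grigorchuk n)) \<le> C * exp (ln 35 * real n)) \<and>
         (\<exists>C>0. \<forall>n\<ge>1.
            real (diam (grigorchuk Mod level_stab_in grigorchuk n))
              \<le> C * ln (real (card (rcosets\<^bsub>grigorchuk\<^esub> level_stab_in grigorchuk n)))
                    powr (ln 35 / ln 2))"
proof -
  obtain c where c: "\<And>n. diam (level_quot n) \<le> 35 ^ n * c" using diam_bound by blast
  define C where "C = real c + 1"
  have C: "C > 0" by (simp add: C_def)
  have exp: "exp (ln 35 * real n) = 35 ^ n" for n
    by (simp add: exp_of_nat2_mult)
  have bound: "real (diam (level_quot n)) \<le> C * exp (ln 35 * real n)" for n
  proof -
    have "real (diam (level_quot n)) \<le> real (35 ^ n * c)" using c of_nat_le_iff by blast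
    also have "\<dots> \<le> C * 35 ^ n" by (simp add: C_def algebra_simps)
    finally show ?thesis by (simp add: exp)
  qed
  define e :: real where "e = ln 35 / ln 2"
  have "real (diam (level_quot n)) \<le> C * (4 / ln 2) powr e *
      ln (real (card (rcosets\<^bsub>grigorchuk\<^esub> level_stab_in grigorchuk n))) powr e" if "n \<ge> 1" for n
  proof -
    let ?L = "ln (real (card (rcosets\<^bsub>grigorchuk\<^esub> level_stab_in grigorchuk n)))"
    have le: "2 ^ n \<le> 4 / ln 2 * ?L" using ln_index_ge[OF that] by (simp add: field_simps)
    have "exp (ln 35 * real n) = (2 ^ n) powr e"
      by (simp add: e_def powr_def ln_realpow mult.commute)
    also have "\<dots> \<le> (4 / ln 2 * ?L) powr e"
      using le by (intro powr_mono2) (simp_all add: e_def)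
    also have "\<dots> = (4 / ln 2) powr e * ?L powr e"
      by (rule powr_mult)
    finally have "C * exp (ln 35 * real n) \<le> C * ((4 / ln 2) powr e * ?L powr e)"
      using C by (intro mult_left_mono) simp_all
    then show ?thesis using bound[of n] by (simp add: mult.assoc)
  qed
  then show ?thesis
    using C bound unfolding e_def[symmetric]
    by (intro conjI exI[of _ C] exI[of _ "C * (4 / ln 2) powr e"]) auto
qed

end
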